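(* Let $V$, $h$, $\varepsilon$, $\varphi$, $X$, $\hat\Gamma$, $B$ and $\hat I$ be as defined in the context, and let $\gamma_0=(r_0,0)\in\hat\Gamma$ be a nonconstant planar critical point of $\hat I$ with $\hat I(\gamma_0)>0$. Suppose that $$I_0(\gamma_0):=\int_0^1V_{rr}(r_0(t),0)\,dt>0.$$ Furthermore, define $$I_1(\gamma_0):=\int_0^1V_{rr}(r_0(t),0)\,r_0(t)\,dt,\qquad I_2(\gamma_0):=\int_0^1V_{rr}(r_0(t),0)\,r_0(t)^2\,dt,$$ and assume that $$I_0(\gamma_0)\bigl(6B(\gamma_0)+I_2(\gamma_0)\bigr)-\bigl(I_1(\gamma_0)\bigr)^2>0.$$ Then the Morse index of the planar solution $\gamma_0$ in the $r$-direction is at least $2$.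
   Context: Let $\omega>0$ and $V(r,z)=\frac{\omega^2}{2r^2}+V_0(r,z)$ for $r>0$, $z\in\mathbb{R}$. Assume: (V1) $V$ is $C^2$; (V2) $V(r,z)=V(r,-z)$; (V3) there exist $h_-<h_+$ such that, for every $h\in(h_-,h_+)$, the Hill region $\Omega_h:=\{(r,z)\mid V(r,z)\le h\}$ is compact and simply connected, does not contain the origin, and satisfies $\nabla V\neq0$ on $\partial\Omega_h=\{V=h\}$; moreover there exists $\varepsilon>0$ such that, for $J=\{r\in\mathbb{R}_+\mid(r,0)\in\operatorname{int}\Omega_{h+2\varepsilon}\}$, there is a continuous function $\zeta:J\to(0,\infty)$ with $\partial\Omega_{h+2\varepsilon}\cap\{z>0\}=\{(r,\zeta(r))\mid r\in J\}$. Fix $h\in(h_-,h_+)$ and $\varepsilon>0$ as in (V3), small enough that $h+2\varepsilon<h_+$, that $\nabla V(r,z)\ne0$ whenever $V(r,z)\in[h,h+2\varepsilon]$, and that $4/\varepsilon^2>h+\frac{3\varepsilon}{2}$. Let $\varphi:(-\infty,h+2\varepsilon)\to\mathbb{R}$ be a $C^\infty$ function with $\varphi'\ge1$, $\varphi(\tau)=\tau$ for $\tau\le h+\varepsilon$, and $\varphi(\tau)=(\tau-h-2\varepsilon)^{-2}$ for $\tau\in[h+\frac{3\varepsilon}{2},h+2\varepsilon)$. Put $\hat V=\varphi\circ V$ on $\hat\Omega:=\operatorname{int}\Omega_{h+2\varepsilon}=\{V<h+2\varepsilon\}$. Let $X=H^1([0,1],\mathbb{R})\times H^1_0([0,1],\mathbb{R})$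 with its standard inner product, $\hat\Gamma=\{\gamma=(r,z)\in X\mid\gamma([0,1])\subset\hat\Omega\}$ (an open subset of $X$), $A(\gamma)=\int_0^1|\gamma'|^2dt$, $B(\gamma)=\int_0^1(h-\hat V(\gamma))\,dt$, and $\hat I=\frac12AB$ on $\hat\Gamma$. For a critical point $\gamma_0$ with $\hat I(\gamma_0)>0$ one has $\gamma_0([0,1])\subset\Omega_h$, where $\hat V=V$. The Morse index of $\gamma_0$ in the $r$-direction is the maximal dimension of a subspace of $\{(u,0)\mid u\in H^1([0,1],\mathbb{R})\}\subset X$ on which the quadratic form $\hat I''(\gamma_0)$ is negative definite. Subscripts on $V$ denote partial derivatives. *)

theory Defs
  imports "HOL-Analysis.Analysis" "HOL-Library.Extended_Nat"
begin

section \<open>The Sobolev spaces \<open>H\<^sup>1\<close> and \<open>H\<^sup>1\<^sub>0\<close> on the unit interval\<close>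

definition L2 :: "(real \<Rightarrow> real) \<Rightarrow> bool" where
  "L2 g \<longleftrightarrow> g \<in> borel_measurable (lebesgue_on {0..1})
      \<and> integrable (lebesgue_on {0..1}) (\<lambda>t. (g t)\<^sup>2)"

text \<open>On an interval a function has a weak derivative in \<open>L\<^sup>2\<close> iff, up to its choice
  on a null set, it is absolutely continuous with derivative in \<open>L\<^sup>2\<close>.  We always work with this
  continuous representative.\<close>

definition weak_deriv :: "(real \<Rightarrow> real) \<Rightarrow> (real \<Rightarrow> real) \<Rightarrow> bool" where
  "weak_deriv u g \<longleftrightarrow> L2 g \<and> (\<forall>t\<in>{0..1}. u t = u 0 + integral {0..t} g)"

lemma L2_mult:
  assumes "L2 f" "L2 g"
  shows "integrable (lebesgue_on {0..1}) (\<lambda>t. f t * g t)"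
proof (rule Bochner_Integration.integrable_bound)
  show "integrable (lebesgue_on {0..1}) (\<lambda>t. (f t)\<^sup>2 + (g t)\<^sup>2)"
    using assms by (auto simp: L2_def)
  show "(\<lambda>t. f t * g t) \<in> borel_measurable (lebesgue_on {0..1})"
    using assms by (auto simp: L2_def)
  have "\<bar>f t * g t\<bar> \<le> (f t)\<^sup>2 + (g t)\<^sup>2" for t
  proof -
    have "0 \<le> (\<bar>f t\<bar> - \<bar>g t\<bar>)\<^sup>2" by simp
    then have "2 * (\<bar>f t\<bar> * \<bar>g t\<bar>) \<le> (f t)\<^sup>2 + (g t)\<^sup>2"
      by (simp add: power2_diff)
    moreover have "0 \<le> \<bar>f t\<bar> * \<bar>g t\<bar>" by simp
    ultimately have "\<bar>f t\<bar> * \<bar>g t\<bar> \<le> (f t)\<^sup>2 + (g t)\<^sup>2" by linarith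
    then show ?thesis by (simp add: abs_mult)
  qed
  then show "AE t in lebesgue_on {0..1}. norm (f t * g t) \<le> norm ((f t)\<^sup>2 + (g t)\<^sup>2)"
    by auto
qed

lemma L2_mult_integrable_on:
  assumes "L2 f" "L2 g"
  shows "(\<lambda>t. f t * g t) integrable_on {0..1}"
  using L2_mult[OF assms] by (rule integrable_on_lebesgue_on) simp

lemma L2_imp_integrable_on:
  assumes "L2 f"
  shows "f integrable_on {0..1}"
proof -
  have "L2 (\<lambda>_. 1)" by (simp add: L2_def)
  from L2_mult_integrable_on[OF assms this] show ?thesis by simp
qed

lemma L2_add: "L2 f \<Longrightarrow> L2 g \<Longrightarrow> L2 (\<lambda>t. f t + g t)"
  using L2_mult[of f g] by (auto simp: L2_def power2_sum mult.assoc)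

lemma L2_scale: "L2 f \<Longrightarrow> L2 (\<lambda>t. c * f t)"
  by (auto simp: L2_def power_mult_distrib)

lemma L2_continuous:
  assumes "continuous_on {0..1} u"
  shows "L2 u"
  unfolding L2_def
proof
  show "u \<in> borel_measurable (lebesgue_on {0..1})"
    by (rule continuous_imp_measurable_on_sets_lebesgue) (use assms in auto)
  have "continuous_on {0..1} (\<lambda>t. (u t)\<^sup>2)"
    using assms by (intro continuous_intros)
  then have "(\<lambda>t. (u t)\<^sup>2) absolutely_integrable_on {0..1}"
    by (rule absolutely_integrable_continuous_real)
  then show "integrable (lebesgue_on {0..1}) (\<lambda>t. (u t)\<^sup>2)"
    by (simp add: set_integrable_def integrable_restrict_space)
qed

lemma weak_derivD:
  assumes "weak_deriv u g"
  shows "L2 g" and "t \<in> {0..1} \<Longrightarrow> u t = u 0 + integral {0..t} g"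
  using assms unfolding weak_deriv_def by blast+

lemma weak_deriv_continuous:
  assumes "weak_deriv u g"
  shows "continuous_on {0..1} u"
proof -
  have "continuous_on {0..1} (\<lambda>t. u 0 + integral {0..t} g)"
    using L2_imp_integrable_on[OF weak_derivD(1)[OF assms]]
    by (intro continuous_intros indefinite_integral_continuous_1)
  then show ?thesis
    by (rule continuous_on_eq) (rule weak_derivD(2)[OF assms, symmetric])
qed

lemma weak_deriv_add:
  assumes "weak_deriv u g" "weak_deriv v k"
  shows "weak_deriv (\<lambda>t. u t + v t) (\<lambda>t. g t + k t)"
  unfolding weak_deriv_def
proof (intro conjI ballI)
  show "L2 (\<lambda>t. g t + k t)"
    using assms by (intro L2_add weak_derivD(1))
  fix t :: real assume t: "t \<in> {0..1}"
  have "g integrable_on {0..t}" "k integrable_on {0..t}"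
    using t assms[THEN weak_derivD(1), THEN L2_imp_integrable_on]
    by (auto intro: integrable_on_subinterval[of _ "{0..1}"])
  then have "integral {0..t} (\<lambda>t. g t + k t) = integral {0..t} g + integral {0..t} k"
    by (rule integral_add)
  with weak_derivD(2)[OF assms(1) t] weak_derivD(2)[OF assms(2) t]
  show "u t + v t = u 0 + v 0 + integral {0..t} (\<lambda>t. g t + k t)"
    by linarith
qed

lemma weak_deriv_scale:
  assumes "weak_deriv u g"
  shows "weak_deriv (\<lambda>t. c * u t) (\<lambda>t. c * g t)"
  unfolding weak_deriv_def
proof (intro conjI ballI)
  show "L2 (\<lambda>t. c * g t)"
    using assms by (intro L2_scale weak_derivD(1))
  fix t :: real assume t: "t \<in> {0..1}"
  have "c * u t = c * (u 0 + integral {0..t} g)"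
    using weak_derivD(2)[OF assms t] by (rule arg_cong)
  then show "c * u t = c * u 0 + integral {0..t} (\<lambda>t. c * g t)"
    by (simp add: distrib_left)
qed

lemma weak_deriv_unique:
  assumes "weak_deriv u g" "weak_deriv u k"
  shows "\<exists>N. negligible N \<and> (\<forall>t\<in>{0..1} - N. g t = k t)"
proof -
  define f where "f t = (if t \<in> {0..1} then g t - k t else 0)" for t :: real
  have gk: "g integrable_on {0..1}" "k integrable_on {0..1}"
    using assms[THEN weak_derivD(1), THEN L2_imp_integrable_on] by auto
  have "f integrable_on UNIV"
    unfolding f_def using gk by (subst integrable_restrict_UNIV) (rule integrable_diff)
  then have f_int: "f integrable_on cbox a b" for a b
    by (rule integrable_on_subcbox) simp
  obtain N where N: "negligible N"
    and *: "\<And>x e. \<lbrakk>x \<notin> N; 0 < e\<rbrakk> \<Longrightarrow> \<exists>d>0. \<forall>h. 0 < h \<and> h < d \<longrightarrow>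
              norm (integral (cbox x (x + h *\<^sub>R One)) f /\<^sub>R h ^ DIM(real) - f x) < e"
    using integrable_ccontinuous_explicit[OF f_int] by metis
  have zero: "integral {0..t} f = 0" if "t \<in> {0..1}" for t
  proof -
    have "integral {0..t} f = integral {0..t} (\<lambda>t. g t - k t)"
      using that by (intro integral_cong) (auto simp: f_def)
    also have "\<dots> = integral {0..t} g - integral {0..t} k"
      using that gk by (intro integral_diff) (auto intro: integrable_on_subinterval)
    also have "\<dots> = (u t - u 0) - (u t - u 0)"
      using weak_derivD(2)[OF assms(1) that] weak_derivD(2)[OF assms(2) that] by linarith
    finally show ?thesis by simp
  qed
  have zero': "integral {x..y} f = 0" if "0 \<le> x" "x \<le> y" "y \<le> 1" for x y
    using Henstock_Kurzweil_Integration.integral_combine[of 0 x y f] f_int[of 0 y]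
      zero[of x] zero[of y] that by auto
  have "f x = 0" if x: "x \<in> {0..1} - insert 1 N" for x
  proof (rule ccontr)
    assume "f x \<noteq> 0"
    with *[of x "\<bar>f x\<bar>"] x obtain d where d: "d > 0"
      "\<And>h. 0 < h \<Longrightarrow> h < d \<Longrightarrow> norm (integral {x..x + h} f /\<^sub>R h - f x) < \<bar>f x\<bar>"
      by auto
    have "0 < min (d / 2) (1 - x)" "min (d / 2) (1 - x) < d"
      using d(1) x by auto
    from d(2)[OF this] zero'[of x "x + min (d / 2) (1 - x)"] x d(1) show False
      by auto
  qed
  then show ?thesis
    using N by (intro exI[of _ "insert 1 N"]) (auto simp: f_def)
qed

definition h1_set :: "(real \<Rightarrow> real) set" where
  "h1_set = {u. (\<exists>g. weak_deriv u g) \<and> (\<forall>t. t \<notin> {0..1} \<longrightarrow> u t = 0)}"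

text \<open>Extending by \<open>0\<close> outside the unit interval makes the representing function unique.\<close>

typedef h1 = h1_set
  morphisms h1_fun Abs_h1
proof
  have "weak_deriv (\<lambda>_. 0) (\<lambda>_. 0)"
    by (simp add: weak_deriv_def L2_def)
  then show "(\<lambda>_. 0) \<in> h1_set" by (auto simp: h1_set_def)
qed

setup_lifting type_definition_h1

definition h1_deriv :: "h1 \<Rightarrow> real \<Rightarrow> real" where
  "h1_deriv u = (SOME g. weak_deriv (h1_fun u) g)"

lemma weak_deriv_h1_deriv: "weak_deriv (h1_fun u) (h1_deriv u)"
proof -
  have "\<exists>g. weak_deriv (h1_fun u) g"
    using h1_fun[of u] by (auto simp: h1_set_def)
  then show ?thesis unfolding h1_deriv_def by (rule someI_ex)
qed

lemma continuous_on_h1_fun: "continuous_on {0..1} (h1_fun u)"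
  using weak_deriv_h1_deriv by (rule weak_deriv_continuous)

lemma h1_fun_outside: "t \<notin> {0..1} \<Longrightarrow> h1_fun u t = 0"
  using h1_fun[of u] by (auto simp: h1_set_def)

lemma h1_eqI:
  assumes "\<And>t. t \<in> {0..1} \<Longrightarrow> h1_fun u t = h1_fun v t"
  shows "u = v"
  using assms h1_fun_outside by (metis ext h1_fun_inject)

lemma L2_h1_fun: "L2 (h1_fun u)"
  by (rule L2_continuous) (rule continuous_on_h1_fun)

lemma L2_h1_deriv: "L2 (h1_deriv u)"
  using weak_deriv_h1_deriv by (rule weak_derivD(1))

instantiation h1 :: real_vector
begin

lift_definition zero_h1 :: h1 is "\<lambda>_. 0"
proof -
  have "weak_deriv (\<lambda>_. 0) (\<lambda>_. 0)"
    by (simp add: weak_deriv_def L2_def)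
  then show "(\<lambda>_. 0) \<in> h1_set" by (auto simp: h1_set_def)
qed

lift_definition plus_h1 :: "h1 \<Rightarrow> h1 \<Rightarrow> h1" is "\<lambda>u v t. u t + v t"
  by (auto simp: h1_set_def intro: weak_deriv_add)

lift_definition scaleR_h1 :: "real \<Rightarrow> h1 \<Rightarrow> h1" is "\<lambda>c u t. c * u t"
  by (auto simp: h1_set_def intro: weak_deriv_scale)

lift_definition uminus_h1 :: "h1 \<Rightarrow> h1" is "\<lambda>u t. - u t"
proof -
  fix u assume "u \<in> h1_set"
  then obtain g where "weak_deriv u g" and "\<forall>t. t \<notin> {0..1} \<longrightarrow> u t = 0"
    by (auto simp: h1_set_def)
  moreover from this(1) have "weak_deriv (\<lambda>t. - 1 * u t) (\<lambda>t. - 1 * g t)"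
    by (rule weak_deriv_scale)
  ultimately show "(\<lambda>t. - u t) \<in> h1_set"
    unfolding h1_set_def mult_minus1 by auto
qed

lift_definition minus_h1 :: "h1 \<Rightarrow> h1 \<Rightarrow> h1" is "\<lambda>u v t. u t - v t"
proof -
  fix u v assume "u \<in> h1_set" "v \<in> h1_set"
  then obtain g k where gk: "weak_deriv u g" "weak_deriv v k"
    and "\<forall>t. t \<notin> {0..1} \<longrightarrow> u t = 0" "\<forall>t. t \<notin> {0..1} \<longrightarrow> v t = 0"
    by (auto simp: h1_set_def)
  moreover have "weak_deriv (\<lambda>t. u t + - 1 * v t) (\<lambda>t. g t + - 1 * k t)"
    using gk by (intro weak_deriv_add weak_deriv_scale)
  ultimately show "(\<lambda>t. u t - v t) \<in> h1_set"
    unfolding h1_set_def mult_minus1 add_uminus_conv_diff by auto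
qed

instance
  by standard (transfer; simp add: fun_eq_iff algebra_simps)+

end

lemma h1_fun_simps [simp]:
  "h1_fun 0 t = 0"
  "h1_fun (u + v) t = h1_fun u t + h1_fun v t"
  "h1_fun (c *\<^sub>R u) t = c * h1_fun u t"
  "h1_fun (- u) t = - h1_fun u t"
  "h1_fun (u - v) t = h1_fun u t - h1_fun v t"
  by (simp_all add: zero_h1.rep_eq plus_h1.rep_eq scaleR_h1.rep_eq uminus_h1.rep_eq minus_h1.rep_eq)

lemma integral_deriv_cong:
  assumes "weak_deriv (h1_fun u) g"
  shows "integral {0..1} (\<lambda>t. h1_deriv u t * k t) = integral {0..1} (\<lambda>t. g t * k t)"
proof -
  obtain N where "negligible N" "\<forall>t\<in>{0..1} - N. h1_deriv u t = g t"
    using weak_deriv_unique[OF weak_deriv_h1_deriv assms] by blast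
  then show ?thesis by (intro integral_spike[of N]) auto
qed

instantiation h1 :: real_inner
begin

definition inner_h1 :: "h1 \<Rightarrow> h1 \<Rightarrow> real" where
  "inner_h1 u v = integral {0..1} (\<lambda>t. h1_fun u t * h1_fun v t)
     + integral {0..1} (\<lambda>t. h1_deriv u t * h1_deriv v t)"

definition norm_h1 :: "h1 \<Rightarrow> real" where
  "norm_h1 u = sqrt (inner u u)"

definition dist_h1 :: "h1 \<Rightarrow> h1 \<Rightarrow> real" where
  "dist_h1 u v = norm (u - v)"

definition sgn_h1 :: "h1 \<Rightarrow> h1" where
  "sgn_h1 u = u /\<^sub>R norm u"

definition uniformity_h1 :: "(h1 \<times> h1) filter" where
  "uniformity_h1 = (INF e\<in>{0<..}. principal {(x, y). dist x y < e})"

definition open_h1 :: "h1 set \<Rightarrow> bool" where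
  "open_h1 U \<longleftrightarrow> (\<forall>x\<in>U. \<forall>\<^sub>F (x', y) in uniformity. x' = x \<longrightarrow> y \<in> U)"

instance
proof
  fix u v w :: h1 and c :: real
  show "inner u v = inner v u"
    by (simp add: inner_h1_def mult.commute)
  have "weak_deriv (h1_fun (u + v)) (\<lambda>t. h1_deriv u t + h1_deriv v t)"
    using weak_deriv_add[OF weak_deriv_h1_deriv weak_deriv_h1_deriv] by (simp add: plus_h1.rep_eq)
  from integral_deriv_cong[OF this]
  show "inner (u + v) w = inner u w + inner v w"
    by (simp add: inner_h1_def distrib_right integral_add L2_mult_integrable_on
        L2_h1_fun L2_h1_deriv)
  have "weak_deriv (h1_fun (c *\<^sub>R u)) (\<lambda>t. c * h1_deriv u t)"
    using weak_deriv_scale[OF weak_deriv_h1_deriv] by (simp add: scaleR_h1.rep_eq)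
  from integral_deriv_cong[OF this]
  show "inner (c *\<^sub>R u) v = c * inner u v"
    by (simp add: inner_h1_def mult.assoc distrib_left)
  have nonneg: "0 \<le> integral {0..1} (\<lambda>t. h1_fun u t * h1_fun u t)"
    "0 \<le> integral {0..1} (\<lambda>t. h1_deriv u t * h1_deriv u t)" for u
    by (simp_all add: integral_nonneg L2_mult_integrable_on L2_h1_fun L2_h1_deriv)
  show "0 \<le> inner u u"
    using nonneg by (simp add: inner_h1_def)
  show "inner u u = 0 \<longleftrightarrow> u = 0"
  proof
    assume "inner u u = 0"
    then have "integral {0..1} (\<lambda>t. h1_fun u t * h1_fun u t) = 0"
      using nonneg[of u] by (simp add: inner_h1_def)
    then have "\<forall>t\<in>{0..1}. h1_fun u t * h1_fun u t = 0"
      by (subst (asm) integral_eq_0_iff) (auto intro!: continuous_intros continuous_on_h1_fun)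
    then show "u = 0" by (auto intro!: h1_eqI)
  next
    assume "u = 0"
    moreover have "weak_deriv (h1_fun 0) (\<lambda>t. 0 * h1_deriv 0 t)"
      using weak_deriv_scale[OF weak_deriv_h1_deriv, of 0 0] by (simp add: zero_h1.rep_eq)
    from integral_deriv_cong[OF this] have "inner (0 :: h1) 0 = 0"
      by (simp add: inner_h1_def)
    ultimately show "inner u u = 0" by simp
  qed
qed (simp_all add: norm_h1_def dist_h1_def sgn_h1_def uniformity_h1_def open_h1_def)

end

typedef h10 = "{u :: h1. h1_fun u 0 = 0 \<and> h1_fun u 1 = 0}"
  morphisms h10_h1 Abs_h10
  by (rule exI[of _ 0]) simp

setup_lifting type_definition_h10

instantiation h10 :: real_vector
begin

lift_definition zero_h10 :: h10 is 0 by simp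
lift_definition plus_h10 :: "h10 \<Rightarrow> h10 \<Rightarrow> h10" is "(+)" by simp
lift_definition minus_h10 :: "h10 \<Rightarrow> h10 \<Rightarrow> h10" is "(-)" by simp
lift_definition uminus_h10 :: "h10 \<Rightarrow> h10" is uminus by simp
lift_definition scaleR_h10 :: "real \<Rightarrow> h10 \<Rightarrow> h10" is scaleR by simp

instance
proof
  fix u v w :: h10 and c d :: real
  show "u + v + w = u + (v + w)" by transfer simp
  show "u + v = v + u" by transfer simp
  show "0 + u = u" by transfer simp
  show "- u + u = 0" by transfer simp
  show "u - v = u + - v" by transfer simp
  show "c *\<^sub>R (u + v) = c *\<^sub>R u + c *\<^sub>R v" by transfer (rule scaleR_add_right)
  show "(c + d) *\<^sub>R u = c *\<^sub>R u + d *\<^sub>R u" by transfer (rule scaleR_add_left)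
  show "c *\<^sub>R d *\<^sub>R u = (c * d) *\<^sub>R u" by transfer simp
  show "1 *\<^sub>R u = u" by transfer simp
qed

end

instantiation h10 :: real_inner
begin

lift_definition inner_h10 :: "h10 \<Rightarrow> h10 \<Rightarrow> real" is inner .
lift_definition norm_h10 :: "h10 \<Rightarrow> real" is norm .
lift_definition dist_h10 :: "h10 \<Rightarrow> h10 \<Rightarrow> real" is dist .

definition sgn_h10 :: "h10 \<Rightarrow> h10" where
  "sgn_h10 u = u /\<^sub>R norm u"

definition uniformity_h10 :: "(h10 \<times> h10) filter" where
  "uniformity_h10 = (INF e\<in>{0<..}. principal {(x, y). dist x y < e})"

definition open_h10 :: "h10 set \<Rightarrow> bool" where
  "open_h10 U \<longleftrightarrow> (\<forall>x\<in>U. \<forall>\<^sub>F (x', y) in uniformity. x' = x \<longrightarrow> y \<in> U)"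

instance
proof
  fix u v w :: h10 and c :: real
  show "inner u v = inner v u" by transfer (rule inner_commute)
  show "inner (u + v) w = inner u w + inner v w" by transfer (rule inner_add_left)
  show "inner (c *\<^sub>R u) v = c * inner u v" by transfer simp
  show "0 \<le> inner u u" by transfer simp
  show "inner u u = 0 \<longleftrightarrow> u = 0" by transfer simp
  show "norm u = sqrt (inner u u)" by transfer (rule norm_eq_sqrt_inner)
  show "dist u v = norm (u - v)" by transfer (rule dist_norm)
qed (simp_all add: sgn_h10_def uniformity_h10_def open_h10_def)

end

section \<open>The potential and its Hill regions\<close>

definition half_plane :: "(real \<times> real) set" where
  "half_plane = {(r, z). 0 < r}"

definition C2_on :: "('a::real_normed_vector \<Rightarrow> 'b::real_normed_vector) \<Rightarrow> 'a set \<Rightarrow> bool" where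
  "C2_on f S \<longleftrightarrow> (\<exists>(f' :: 'a \<Rightarrow> 'a \<Rightarrow>\<^sub>L 'b) (f'' :: 'a \<Rightarrow> 'a \<Rightarrow>\<^sub>L 'a \<Rightarrow>\<^sub>L 'b).
      (\<forall>x\<in>S. (f has_derivative blinfun_apply (f' x)) (at x)) \<and>
      (\<forall>x\<in>S. (f' has_derivative blinfun_apply (f'' x)) (at x)) \<and>
      continuous_on S f'')"

definition grad :: "(real \<times> real \<Rightarrow> real) \<Rightarrow> real \<times> real \<Rightarrow> real \<times> real" where
  "grad V = (\<lambda>(r, z). (deriv (\<lambda>\<rho>. V (\<rho>, z)) r, deriv (\<lambda>\<zeta>. V (r, \<zeta>)) z))"

definition V_rr :: "(real \<times> real \<Rightarrow> real) \<Rightarrow> real \<Rightarrow> real \<Rightarrow> real" where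
  "V_rr V r z = deriv (deriv (\<lambda>\<rho>. V (\<rho>, z))) r"

definition hill :: "(real \<times> real \<Rightarrow> real) \<Rightarrow> real \<Rightarrow> (real \<times> real) set" where
  "hill V h = {p \<in> half_plane. V p \<le> h}"

definition upper_graph :: "(real \<times> real \<Rightarrow> real) \<Rightarrow> real \<Rightarrow> bool" where
  "upper_graph V e \<longleftrightarrow>
    (let J = {r. 0 < r \<and> (r, 0) \<in> interior (hill V e)} in
      \<exists>\<zeta>. continuous_on J \<zeta> \<and> (\<forall>r\<in>J. 0 < \<zeta> r) \<and>
        frontier (hill V e) \<inter> {(r, z). 0 < z} = {(r, \<zeta> r) | r. r \<in> J})"

definition V3 :: "(real \<times> real \<Rightarrow> real) \<Rightarrow> real \<Rightarrow> real \<Rightarrow> bool" where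
  "V3 V hm hp \<longleftrightarrow> hm < hp \<and>
    (\<forall>h. hm < h \<and> h < hp \<longrightarrow>
      compact (hill V h) \<and> simply_connected (hill V h) \<and> (0, 0) \<notin> hill V h \<and>
      frontier (hill V h) = {p \<in> half_plane. V p = h} \<and>
      (\<forall>p\<in>frontier (hill V h). grad V p \<noteq> 0) \<and>
      (\<exists>\<epsilon>>0. upper_graph V (h + 2 * \<epsilon>)))"

definition smooth_on_reals :: "(real \<Rightarrow> real) \<Rightarrow> real set \<Rightarrow> bool" where
  "smooth_on_reals f S \<longleftrightarrow> (\<forall>n. \<forall>x\<in>S. ((deriv ^^ n) f) differentiable (at x))"

definition admissible_cutoff :: "(real \<Rightarrow> real) \<Rightarrow> real \<Rightarrow> real \<Rightarrow> bool" where
  "admissible_cutoff \<phi> h \<epsilon> \<longleftrightarrow>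
    smooth_on_reals \<phi> {..<h + 2 * \<epsilon>} \<and>
    (\<forall>\<tau><h + 2 * \<epsilon>. 1 \<le> deriv \<phi> \<tau>) \<and>
    (\<forall>\<tau>\<le>h + \<epsilon>. \<phi> \<tau> = \<tau>) \<and>
    (\<forall>\<tau>\<in>{h + 3 * \<epsilon> / 2..<h + 2 * \<epsilon>}. \<phi> \<tau> = 1 / (\<tau> - h - 2 * \<epsilon>)\<^sup>2)"

section \<open>The functional\<close>

type_synonym path_space = "h1 \<times> h10"

definition curve :: "path_space \<Rightarrow> real \<Rightarrow> real \<times> real" where
  "curve \<gamma> t = (h1_fun (fst \<gamma>) t, h1_fun (h10_h1 (snd \<gamma>)) t)"

definition Gamma_hat :: "(real \<times> real \<Rightarrow> real) \<Rightarrow> real \<Rightarrow> real \<Rightarrow> path_space set" where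
  "Gamma_hat V h \<epsilon> = {\<gamma>. curve \<gamma> ` {0..1} \<subseteq> interior (hill V (h + 2 * \<epsilon>))}"

definition A_fun :: "path_space \<Rightarrow> real" where
  "A_fun \<gamma> = integral {0..1} (\<lambda>t. (h1_deriv (fst \<gamma>) t)\<^sup>2 + (h1_deriv (h10_h1 (snd \<gamma>)) t)\<^sup>2)"

definition B_fun :: "(real \<times> real \<Rightarrow> real) \<Rightarrow> (real \<Rightarrow> real) \<Rightarrow> real \<Rightarrow> path_space \<Rightarrow> real" where
  "B_fun V \<phi> h \<gamma> = integral {0..1} (\<lambda>t. h - (\<phi> \<circ> V) (curve \<gamma> t))"

text \<open>Off the open set \<open>Gamma_hat\<close> the value of \<open>I_hat\<close> has no meaning; it does not
  influence derivatives at points of \<open>Gamma_hat\<close>.\<close>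

definition I_hat :: "(real \<times> real \<Rightarrow> real) \<Rightarrow> (real \<Rightarrow> real) \<Rightarrow> real \<Rightarrow> path_space \<Rightarrow> real" where
  "I_hat V \<phi> h \<gamma> = 1 / 2 * A_fun \<gamma> * B_fun V \<phi> h \<gamma>"

section \<open>Critical points and Morse index\<close>

definition critical_point :: "('a::real_normed_vector \<Rightarrow> real) \<Rightarrow> 'a \<Rightarrow> bool" where
  "critical_point f x \<longleftrightarrow> (f has_derivative (\<lambda>_. 0)) (at x)"

definition first_deriv :: "('a::real_normed_vector \<Rightarrow> real) \<Rightarrow> 'a \<Rightarrow> 'a \<Rightarrow>\<^sub>L real" where
  "first_deriv f x = Blinfun (frechet_derivative f (at x))"

definition second_deriv :: "('a::real_normed_vector \<Rightarrow> real) \<Rightarrow> 'a \<Rightarrow> 'a \<Rightarrow> 'a \<Rightarrow>\<^sub>L real" where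
  "second_deriv f x = frechet_derivative (first_deriv f) (at x)"

text \<open>The maximal dimension of a subspace of \<open>W\<close> on which \<open>f''(x)\<close> is negative
  definite, as a supremum over finite-dimensional subspaces (\<open>\<infinity>\<close> if unbounded); \<open>dim\<close> would
  report \<open>0\<close> on infinite-dimensional ones.\<close>

definition morse_index_on :: "'a::real_normed_vector set \<Rightarrow> ('a \<Rightarrow> real) \<Rightarrow> 'a \<Rightarrow> enat" where
  "morse_index_on W f x = Sup {enat (dim S) | S. subspace S \<and> S \<subseteq> W \<and>
     (\<exists>b. finite b \<and> span b = S) \<and> (\<forall>v\<in>S - {0}. blinfun_apply (second_deriv f x v) v < 0)}"

definition morse_index_r :: "(path_space \<Rightarrow> real) \<Rightarrow> path_space \<Rightarrow> enat" where
  "morse_index_r f \<gamma> = morse_index_on {(u, 0) | u. True} f \<gamma>"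

section \<open>The integrals along a planar curve\<close>

definition I_0 :: "(real \<times> real \<Rightarrow> real) \<Rightarrow> h1 \<Rightarrow> real" where
  "I_0 V r\<^sub>0 = integral {0..1} (\<lambda>t. V_rr V (h1_fun r\<^sub>0 t) 0)"

definition I_1 :: "(real \<times> real \<Rightarrow> real) \<Rightarrow> h1 \<Rightarrow> real" where
  "I_1 V r\<^sub>0 = integral {0..1} (\<lambda>t. V_rr V (h1_fun r\<^sub>0 t) 0 * h1_fun r\<^sub>0 t)"

definition I_2 :: "(real \<times> real \<Rightarrow> real) \<Rightarrow> h1 \<Rightarrow> real" where
  "I_2 V r\<^sub>0 = integral {0..1} (\<lambda>t. V_rr V (h1_fun r\<^sub>0 t) 0 * (h1_fun r\<^sub>0 t)\<^sup>2)"

end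

theory Submission
  imports Defs
begin

text \<open>On the variations \<open>\<xi> = (a + b r\<^sub>0, 0)\<close> with real \<open>a, b\<close> the Hessian of
  \<open>I = A B / 2\<close> at \<open>\<gamma>\<^sub>0 = (r\<^sub>0, 0)\<close> is explicit.  Since constants do not contribute to \<open>A\<close>,
  one has \<open>A'(\<xi>) = 2 b A\<close> and \<open>A''(\<xi>, \<xi>) = 2 b\<^sup>2 A\<close>.  The critical point equation
  \<open>A' B + A B' = 0\<close> then gives \<open>B'(\<xi>) = - 2 b B\<close>.  Near the curve the cut-off is the
  identity, so \<open>B''(\<xi>, \<xi>) = - (a\<^sup>2 I\<^sub>0 + 2 a b I\<^sub>1 + b\<^sup>2 I\<^sub>2)\<close>.  Together,
  \<open>I''(\<xi>, \<xi>) = - A / 2 * (a\<^sup>2 I\<^sub>0 + 2 a b I\<^sub>1 + b\<^sup>2 (6 B + I\<^sub>2))\<close>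
  (\<open>second_deriv_constants_dilations\<close>).  The two hypotheses on \<open>I\<^sub>0\<close>, \<open>I\<^sub>1\<close>, \<open>I\<^sub>2\<close> say that the
  leading coefficient and the determinant of the form in brackets are positive, and \<open>A, B > 0\<close>
  because \<open>A \<ge> 0\<close> and \<open>I > 0\<close>.  So the Hessian is negative definite on these variations, and they
  form a plane because \<open>r\<^sub>0\<close> is not constant.

  Two analytic facts support this computation.  The first is that \<open>I\<close> really is twice Frechet
  differentiable at \<open>\<gamma>\<^sub>0\<close>.  The part \<open>A\<close> is a bounded quadratic form.  For \<open>B\<close>, the Sobolev embedding
  \<open>norm_curve_le\<close> bounds the uniform norm of a curve by its norm in the path space, and in the
  uniform norm superposition by a \<open>C\<^sup>1\<close> map is differentiable
  (\<open>superposition_integral_has_derivative\<close>, \<open>superposition_pairing_has_derivative\<close>).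

  The second is that the critical curve lies in \<open>{V \<le> h}\<close>, where the cut-off is inactive
  (\<open>critical_planar_in_hill\<close>).  This is conservation of energy: a planar critical point solves
  Newton's equation with free end points, the quantity \<open>r\<^sub>0'\<^sup>2 / 2 - A / (2 B) (h - \<phi> (V (r\<^sub>0, 0)))\<close>
  is constant, and its mean over the interval is \<open>A / 2 - A / (2 B) * B = 0\<close>.  Hence
  \<open>h - \<phi> (V (r\<^sub>0, 0)) = B / A * r\<^sub>0'\<^sup>2 \<ge> 0\<close> (\<open>planar_energy_nonneg\<close>).\<close>

section \<open>Sobolev embedding and continuity of curves\<close>

lemma L2_abs_integral_le:
  assumes "L2 g" "integral {0..1} (\<lambda>t. (g t)\<^sup>2) \<le> 1" "0 \<le> a" "b \<le> 1"
  shows "\<bar>integral {a..b} g\<bar> \<le> 1"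
proof -
  have sub: "{a..b} \<subseteq> {0..1}"
    using assms by auto
  have sq: "(\<lambda>t. (g t)\<^sup>2) integrable_on {0..1}"
    using L2_mult_integrable_on[OF assms(1) assms(1)] by (simp add: power2_eq_square)
  then have dom: "(\<lambda>t. ((g t)\<^sup>2 + 1) / 2) integrable_on {0..1}"
    by (intro integrable_on_divide integrable_add integrable_const_ivl)
  have "\<bar>g t\<bar> \<le> ((g t)\<^sup>2 + 1) / 2" for t
    using sum_squares_bound[of "\<bar>g t\<bar>" 1] by simp
  then have "norm (integral {a..b} g) \<le> integral {a..b} (\<lambda>t. ((g t)\<^sup>2 + 1) / 2)"
    using sub L2_imp_integrable_on[OF assms(1)] dom
    by (intro integral_norm_bound_integral) (auto intro: integrable_on_subinterval)
  also have "\<dots> \<le> integral {0..1} (\<lambda>t. ((g t)\<^sup>2 + 1) / 2)"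
    using sub dom by (intro integral_subset_le) (auto intro: integrable_on_subinterval)
  also have "\<dots> = (integral {0..1} (\<lambda>t. (g t)\<^sup>2) + 1) / 2"
    using sq by (simp add: integral_add integrable_const_ivl)
  finally show ?thesis
    using assms(2) by simp
qed

text \<open>The mean value of \<open>u\<^sup>2\<close> is at most \<open>1\<close>, so \<open>\<bar>u\<bar> \<le> 1\<close> somewhere, and from there \<open>u\<close> changes by
  at most the \<open>L\<^sup>1\<close> norm of its derivative.  Restricting to the unit ball replaces the
  Cauchy-Schwarz inequality by the elementary bound \<open>2 \<bar>g\<bar> \<le> g\<^sup>2 + 1\<close>.\<close>

lemma h1_fun_le_unit_ball:
  assumes "norm u \<le> 1" "t \<in> {0..1}"
  shows "\<bar>h1_fun u t\<bar> \<le> 2"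
proof -
  have "inner u u \<le> 1"
    using assms(1) by (simp add: dot_square_norm power_le_one)
  moreover have "0 \<le> integral {0..1} (\<lambda>t. h1_fun u t * h1_fun u t)"
    "0 \<le> integral {0..1} (\<lambda>t. h1_deriv u t * h1_deriv u t)"
    by (simp_all add: integral_nonneg L2_mult_integrable_on L2_h1_fun L2_h1_deriv)
  ultimately have le: "integral {0..1} (\<lambda>t. h1_fun u t * h1_fun u t) \<le> 1"
    "integral {0..1} (\<lambda>t. (h1_deriv u t)\<^sup>2) \<le> 1"
    by (simp_all add: inner_h1_def power2_eq_square)
  obtain s where s: "s \<in> {0..1}" "\<And>y. y \<in> {0..1} \<Longrightarrow> \<bar>h1_fun u s\<bar> \<le> \<bar>h1_fun u y\<bar>"
    using continuous_attains_inf[of "{0..1}" "\<lambda>y. \<bar>h1_fun u y\<bar>"]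
      continuous_on_rabs[OF continuous_on_h1_fun]
    by fastforce
  have "(h1_fun u s)\<^sup>2 \<le> h1_fun u y * h1_fun u y" if "y \<in> {0..1}" for y
    using power_mono[OF s(2)[OF that], of 2] by (simp add: power2_eq_square)
  then have "integral {0..1} (\<lambda>y::real. (h1_fun u s)\<^sup>2) \<le> integral {0..1} (\<lambda>t. h1_fun u t * h1_fun u t)"
    by (intro integral_le) (auto simp: L2_mult_integrable_on L2_h1_fun)
  then have "(h1_fun u s)\<^sup>2 \<le> 1"
    using le by simp
  then have us: "\<bar>h1_fun u s\<bar> \<le> 1"
    by (simp add: abs_square_le_1)
  have int: "h1_deriv u integrable_on {a..b}" if "0 \<le> a" "b \<le> 1" for a b
    using that integrable_on_subinterval[OF L2_imp_integrable_on[OF L2_h1_deriv], of a b u] by auto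
  have step: "h1_fun u y = h1_fun u x + integral {x..y} (h1_deriv u)"
    if "x \<in> {0..1}" "y \<in> {0..1}" "x \<le> y" for x y
    using weak_derivD(2)[OF weak_deriv_h1_deriv that(1)] weak_derivD(2)[OF weak_deriv_h1_deriv that(2)]
      Henstock_Kurzweil_Integration.integral_combine[of 0 x y "h1_deriv u"] int[of 0 y] that
    by auto
  have "\<bar>integral {x..y} (h1_deriv u)\<bar> \<le> 1" if "x \<in> {0..1}" "y \<in> {0..1}" for x y
    using that le by (intro L2_abs_integral_le L2_h1_deriv) auto
  then show ?thesis
    using step[of s t] step[of t s] s(1) assms(2) us
    by (smt (verit, best))
qed

lemma h1_fun_bound: "\<bar>h1_fun u t\<bar> \<le> 2 * norm u"
proof (cases "t \<in> {0..1} \<and> u \<noteq> 0")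
  case True
  then have "\<bar>h1_fun (u /\<^sub>R norm u) t\<bar> \<le> 2"
    by (intro h1_fun_le_unit_ball) auto
  then show ?thesis
    using True by (simp add: abs_mult field_simps)
next
  case False
  then show ?thesis
    using h1_fun_outside[of t u] by auto
qed

lemma h10_h1_add: "h10_h1 (u + v) = h10_h1 u + h10_h1 v"
  and h10_h1_scaleR: "h10_h1 (c *\<^sub>R u) = c *\<^sub>R h10_h1 u"
  and h10_h1_zero: "h10_h1 0 = 0"
  by (simp_all add: plus_h10.rep_eq scaleR_h10.rep_eq zero_h10.rep_eq)

lemma curve_add: "curve (\<gamma> + \<eta>) t = curve \<gamma> t + curve \<eta> t"
  and curve_scaleR: "curve (c *\<^sub>R \<gamma>) t = c *\<^sub>R curve \<gamma> t"
  by (simp_all add: curve_def h10_h1_add h10_h1_scaleR)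

lemma curve_diff: "curve (\<gamma> - \<eta>) t = curve \<gamma> t - curve \<eta> t"
  using curve_add[of "\<gamma> - \<eta>" \<eta> t] by simp

lemma norm_curve_le: "norm (curve \<gamma> t) \<le> 2 * norm \<gamma>"
proof -
  have "(h1_fun (fst \<gamma>) t)\<^sup>2 \<le> (2 * norm (fst \<gamma>))\<^sup>2"
    by (rule abs_le_square_iff[THEN iffD1]) (use h1_fun_bound[of "fst \<gamma>" t] in simp)
  moreover have "(h1_fun (h10_h1 (snd \<gamma>)) t)\<^sup>2 \<le> (2 * norm (snd \<gamma>))\<^sup>2"
    by (rule abs_le_square_iff[THEN iffD1])
      (use h1_fun_bound[of "h10_h1 (snd \<gamma>)" t] in \<open>simp add: norm_h10.rep_eq\<close>)
  ultimately have "(norm (curve \<gamma> t))\<^sup>2 \<le> (2 * norm \<gamma>)\<^sup>2"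
    by (simp add: curve_def norm_Pair norm_prod_def power_mult_distrib)
  then show ?thesis
    by (rule power2_le_imp_le) simp
qed

lemma continuous_on_curve [continuous_intros]: "continuous_on {0..1} (curve \<gamma>)"
  unfolding curve_def[abs_def] by (intro continuous_intros continuous_on_h1_fun)

lemma compact_curve: "compact (curve \<gamma> ` {0..1})"
  by (intro compact_continuous_image continuous_on_curve) simp

lemma L2_h1_deriv_products:
  "(\<lambda>t. h1_deriv u t * h1_deriv v t) integrable_on {0..1}"
  by (intro L2_mult_integrable_on L2_h1_deriv)

section \<open>The kinetic form\<close>

definition kinetic :: "path_space \<Rightarrow> path_space \<Rightarrow> real" where
  "kinetic \<gamma> \<xi> = integral {0..1} (\<lambda>t. h1_deriv (fst \<gamma>) t * h1_deriv (fst \<xi>) t)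
     + integral {0..1} (\<lambda>t. h1_deriv (h10_h1 (snd \<gamma>)) t * h1_deriv (h10_h1 (snd \<xi>)) t)"

text \<open>The derivatives are only determined up to null sets, so linearity of the
  kinetic form is read off from the inner product of the path space instead.\<close>

lemma kinetic_eq: "kinetic \<gamma> \<xi> = inner \<gamma> \<xi> - integral {0..1} (\<lambda>t. inner (curve \<gamma> t) (curve \<xi> t))"
  by (simp add: kinetic_def inner_prod_def inner_h1_def inner_h10.rep_eq curve_def integral_add
      L2_mult_integrable_on L2_h1_fun)

lemma A_fun_eq_kinetic: "A_fun \<gamma> = kinetic \<gamma> \<gamma>"
  by (simp add: A_fun_def kinetic_def power2_eq_square integral_add L2_h1_deriv_products)

lemma kinetic_sym: "kinetic \<gamma> \<xi> = kinetic \<xi> \<gamma>"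
  by (simp add: kinetic_def mult.commute)

lemma bounded_bilinear_kinetic: "bounded_bilinear kinetic"
proof -
  have int: "(\<lambda>t. inner (curve \<gamma> t) (curve \<xi> t)) integrable_on {0..1}" for \<gamma> \<xi>
    by (intro integrable_continuous_real continuous_intros)
  have add: "kinetic (\<gamma> + \<eta>) \<xi> = kinetic \<gamma> \<xi> + kinetic \<eta> \<xi>" for \<gamma> \<eta> \<xi>
    by (simp add: kinetic_eq curve_add inner_add_left integral_add int)
  have scale: "kinetic (c *\<^sub>R \<gamma>) \<xi> = c *\<^sub>R kinetic \<gamma> \<xi>" for c \<gamma> \<xi>
    by (simp add: kinetic_eq curve_scaleR algebra_simps)
  have "norm (kinetic \<gamma> \<xi>) \<le> norm \<gamma> * norm \<xi> * 5" for \<gamma> \<xi>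
  proof -
    have "norm (inner (curve \<gamma> t) (curve \<xi> t)) \<le> 4 * norm \<gamma> * norm \<xi>" for t
      using Cauchy_Schwarz_ineq2[of "curve \<gamma> t" "curve \<xi> t"]
        mult_mono[OF norm_curve_le[of \<gamma> t] norm_curve_le[of \<xi> t]]
      by simp
    then have "norm (integral {0..1} (\<lambda>t. inner (curve \<gamma> t) (curve \<xi> t)))
        \<le> integral {0..1} (\<lambda>t::real. 4 * norm \<gamma> * norm \<xi>)"
      by (intro integral_norm_bound_integral int) auto
    then show ?thesis
      using Cauchy_Schwarz_ineq2[of \<gamma> \<xi>] by (simp add: kinetic_eq)
  qed
  then show ?thesis
    using add scale kinetic_sym by (intro bounded_bilinear.intro) metis+
qed

interpretation kinetic: bounded_bilinear kinetic
  by (rule bounded_bilinear_kinetic)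

lemma A_fun_has_derivative:
  "(A_fun has_derivative blinfun_apply (2 *\<^sub>R kinetic.prod_right \<gamma>)) (at \<gamma>)"
proof -
  have "((\<lambda>\<gamma>. kinetic \<gamma> \<gamma>) has_derivative (\<lambda>\<xi>. kinetic \<gamma> \<xi> + kinetic \<xi> \<gamma>)) (at \<gamma>)"
    by (rule kinetic.FDERIV) (rule has_derivative_ident)+
  moreover have "(\<lambda>\<xi>. kinetic \<gamma> \<xi> + kinetic \<xi> \<gamma>) = blinfun_apply (2 *\<^sub>R kinetic.prod_right \<gamma>)"
    by (rule ext) (metis kinetic_sym mult_2 blinfun.scaleR_left kinetic.prod_right.rep_eq real_scaleR_def)
  ultimately show ?thesis
    by (simp add: A_fun_eq_kinetic[abs_def])
qed

section \<open>Superposition operators\<close>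

text \<open>The derivative of a \<open>C\<^sup>1\<close> map is uniformly continuous on a compact neighbourhood of a compact
  set, so its Taylor remainder is small uniformly in the base point.  Applied to the points of a
  curve, this makes superposition by the map differentiable in the uniform norm.\<close>

lemma uniform_first_order_expansion:
  fixes F :: "'a::euclidean_space \<Rightarrow> 'b::real_normed_vector" and F' :: "'a \<Rightarrow> 'a \<Rightarrow>\<^sub>L 'b"
  assumes "open U" "compact K" "K \<subseteq> U"
    and der: "\<And>x. x \<in> U \<Longrightarrow> (F has_derivative blinfun_apply (F' x)) (at x)"
    and cont: "continuous_on U F'" and "0 < e"
  shows "\<exists>d>0. \<forall>p\<in>K. \<forall>q. norm q < d \<longrightarrow>
    p + q \<in> U \<and> norm (F (p + q) - F p - blinfun_apply (F' p) q) \<le> e * norm q"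
proof -
  obtain r where r: "r > 0" "(\<Union>x\<in>K. cball x r) \<subseteq> U"
    using compact_subset_open_imp_cball_epsilon_subset[OF assms(2,1,3)] by blast
  define L where "L = {x + y |x y. x \<in> K \<and> y \<in> cball 0 r}"
  have "L \<subseteq> U"
    using r(2) by (fastforce simp: L_def dist_norm)
  moreover have "compact L"
    unfolding L_def using assms(2) by (intro compact_sums) auto
  ultimately have "uniformly_continuous_on L F'"
    using cont by (intro compact_uniformly_continuous) (auto intro: continuous_on_subset)
  then obtain d where d: "d > 0"
    "\<And>x y. x \<in> L \<Longrightarrow> y \<in> L \<Longrightarrow> dist y x < d \<Longrightarrow> dist (F' y) (F' x) < e"
    using \<open>0 < e\<close> unfolding uniformly_continuous_on_def by meson
  have inL: "p + q \<in> L" if "p \<in> K" "norm q < r" for p q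
    using that unfolding L_def by (fastforce simp: less_imp_le)
  have "norm (F (p + q) - F p - blinfun_apply (F' p) q) \<le> e * norm q"
    if p: "p \<in> K" and q: "norm q < min d r" for p q
  proof -
    define S where "S = ball p (min d r)"
    have SL: "x \<in> L" if "x \<in> S" for x
      using that inL[OF p, of "x - p"] by (simp add: S_def dist_norm norm_minus_commute)
    have "norm (F (p + q) - F p - blinfun_apply (F' p) (p + q - p)) \<le> norm (p + q - p) * e"
    proof (rule differentiable_bound_linearization[where S = S])
      fix t :: real assume "t \<in> {0..1}"
      then have "\<bar>t\<bar> * norm q \<le> norm q"
        by (simp add: mult_left_le_one_le)
      then show "p + t *\<^sub>R (p + q - p) \<in> S"
        using q by (simp add: S_def dist_norm)
    next
      fix x assume x: "x \<in> S"
      show "(F has_derivative blinfun_apply (F' x)) (at x within S)"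
        using der SL[OF x] \<open>L \<subseteq> U\<close> by (blast intro: has_derivative_at_withinI)
      have "dist (F' x) (F' p) < e"
        using x SL[OF x] inL[OF p, of 0] r(1) by (intro d) (auto simp: S_def dist_commute)
      moreover have "onorm (blinfun_apply (F' x) - blinfun_apply (F' p)) = norm (F' x - F' p)"
        by (simp add: norm_blinfun.rep_eq minus_blinfun.rep_eq fun_diff_def)
      ultimately show "onorm (blinfun_apply (F' x) - blinfun_apply (F' p)) \<le> e"
        by (simp add: dist_norm)
    next
      show "p \<in> S"
        using d(1) r(1) by (simp add: S_def)
    qed
    then show ?thesis
      by (simp add: mult.commute)
  qed
  moreover have "p + q \<in> U" if "p \<in> K" "norm q < min d r" for p q
    using inL[OF that(1), of q] that(2) \<open>L \<subseteq> U\<close> by auto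
  moreover have "0 < min d r"
    using d(1) r(1) by simp
  ultimately show ?thesis
    by blast
qed

text \<open>Covector fields along the unit interval are integrated against curve variations.  Continuity of
  the field makes the integral a bounded linear function of the variation, which is what gives
  \<open>Blinfun\<close> its meaning here.\<close>

definition pairing :: "(real \<Rightarrow> (real \<times> real) \<Rightarrow>\<^sub>L real) \<Rightarrow> path_space \<Rightarrow>\<^sub>L real" where
  "pairing g = Blinfun (\<lambda>\<xi>. integral {0..1} (\<lambda>t. blinfun_apply (g t) (curve \<xi> t)))"

lemma pairing_integrable:
  fixes g :: "real \<Rightarrow> (real \<times> real) \<Rightarrow>\<^sub>L real"
  assumes "continuous_on {0..1} g"
  shows "(\<lambda>t. blinfun_apply (g t) (curve \<xi> t)) integrable_on {0..1}"
  by (intro integrable_continuous_real blinfun.continuous_on assms continuous_on_curve)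

lemma pairing_le:
  fixes g :: "real \<Rightarrow> (real \<times> real) \<Rightarrow>\<^sub>L real"
  assumes "continuous_on {0..1} g" "\<And>t. t \<in> {0..1} \<Longrightarrow> norm (g t) \<le> M"
  shows "norm (integral {0..1} (\<lambda>t. blinfun_apply (g t) (curve \<xi> t))) \<le> 2 * M * norm \<xi>"
proof -
  have "norm (blinfun_apply (g t) (curve \<xi> t)) \<le> 2 * M * norm \<xi>" if "t \<in> {0..1}" for t
  proof -
    have "0 \<le> M"
      using assms(2)[OF that] norm_ge_zero order_trans by blast
    then show ?thesis
      using norm_blinfun[of "g t" "curve \<xi> t"]
        mult_mono[OF assms(2)[OF that] norm_curve_le[of \<xi> t]]
      by simp
  qed
  then have "norm (integral {0..1} (\<lambda>t. blinfun_apply (g t) (curve \<xi> t))) \<le> integral {0..1} (\<lambda>t::real. 2 * M * norm \<xi>)"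
    by (intro integral_norm_bound_integral pairing_integrable assms(1)) auto
  then show ?thesis
    by simp
qed

lemma continuous_on_unit_interval_bounded:
  fixes g :: "real \<Rightarrow> 'a::real_normed_vector"
  assumes "continuous_on {0..1} g"
  obtains M where "0 \<le> M" "\<And>t. t \<in> {0..1} \<Longrightarrow> norm (g t) \<le> M"
proof -
  have "bounded (g ` {0..1})"
    using assms by (intro compact_imp_bounded compact_continuous_image) auto
  then obtain M where M: "\<And>t. t \<in> {0..1} \<Longrightarrow> norm (g t) \<le> M"
    unfolding bounded_iff by blast
  moreover from M[of 0] have "0 \<le> M"
    using norm_ge_zero[of "g 0"] by (auto simp del: norm_ge_zero)
  ultimately show thesis
    using that by blast
qed

lemma pairing_apply:
  assumes "continuous_on {0..1} g"
  shows "blinfun_apply (pairing g) \<xi> = integral {0..1} (\<lambda>t. blinfun_apply (g t) (curve \<xi> t))"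
proof -
  obtain M where M: "\<And>t. t \<in> {0..1} \<Longrightarrow> norm (g t) \<le> M"
    using continuous_on_unit_interval_bounded[OF assms] by blast
  have "bounded_linear (\<lambda>\<xi>. integral {0..1} (\<lambda>t. blinfun_apply (g t) (curve \<xi> t)))"
  proof (rule bounded_linear_intro[where K = "2 * M"])
    show "norm (integral {0..1} (\<lambda>t. blinfun_apply (g t) (curve \<xi> t))) \<le> norm \<xi> * (2 * M)" for \<xi>
      using pairing_le[OF assms M] by (simp add: mult.commute)
  qed (simp_all add: curve_add curve_scaleR blinfun.add_right blinfun.scaleR_right integral_add
      pairing_integrable assms)
  then show ?thesis
    by (simp add: pairing_def bounded_linear_Blinfun_apply)
qed

lemma norm_pairing_le:
  assumes "continuous_on {0..1} g" "\<And>t. t \<in> {0..1} \<Longrightarrow> norm (g t) \<le> M" "0 \<le> M"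
  shows "norm (pairing g) \<le> 2 * M"
proof (rule norm_blinfun_bound)
  show "norm (blinfun_apply (pairing g) \<xi>) \<le> 2 * M * norm \<xi>" for \<xi>
    using pairing_le[OF assms(1,2)] by (simp only: pairing_apply[OF assms(1)])
qed (use assms(3) in simp)

lemma pairing_add:
  assumes "continuous_on {0..1} f" "continuous_on {0..1} g"
  shows "pairing (\<lambda>t. f t + g t) = pairing f + pairing g"
  by (rule blinfun_eqI)
    (simp add: pairing_apply assms continuous_on_add blinfun.add_left integral_add pairing_integrable)

lemma pairing_diff:
  assumes "continuous_on {0..1} f" "continuous_on {0..1} g"
  shows "pairing (\<lambda>t. f t - g t) = pairing f - pairing g"
  by (rule blinfun_eqI)
    (simp add: pairing_apply assms continuous_on_diff blinfun.diff_left integral_diff pairing_integrable)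

lemma pairing_scaleR:
  assumes "continuous_on {0..1} f"
  shows "pairing (\<lambda>t. c *\<^sub>R f t) = c *\<^sub>R pairing f"
  by (rule blinfun_eqI)
    (simp add: pairing_apply assms continuous_on_scaleR blinfun.scaleR_left)

lemma superposition_integral_has_derivative:
  fixes F :: "real \<times> real \<Rightarrow> real" and F' :: "real \<times> real \<Rightarrow> (real \<times> real) \<Rightarrow>\<^sub>L real"
  assumes U: "open U" "curve \<gamma> ` {0..1} \<subseteq> U"
    and der: "\<And>x. x \<in> U \<Longrightarrow> (F has_derivative blinfun_apply (F' x)) (at x)"
    and cont: "continuous_on U F'"
  shows "((\<lambda>\<gamma>. integral {0..1} (\<lambda>t. F (curve \<gamma> t))) has_derivative
    blinfun_apply (pairing (\<lambda>t. F' (curve \<gamma> t)))) (at \<gamma>)"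
  unfolding has_derivative_at_alt
proof (intro conjI allI impI blinfun.bounded_linear_right)
  fix e :: real assume "0 < e"
  then have "0 < e / 2"
    by simp
  have "\<exists>d>0. \<forall>p\<in>curve \<gamma> ` {0..1}. \<forall>q. norm q < d \<longrightarrow>
      p + q \<in> U \<and> norm (F (p + q) - F p - blinfun_apply (F' p) q) \<le> e / 2 * norm q"
    by (rule uniform_first_order_expansion[OF U(1) compact_curve U(2) der cont \<open>0 < e / 2\<close>])
  then obtain d where d_pos: "0 < d" and expansion: "\<forall>p\<in>curve \<gamma> ` {0..1}. \<forall>q. norm q < d \<longrightarrow>
      p + q \<in> U \<and> norm (F (p + q) - F p - blinfun_apply (F' p) q) \<le> e / 2 * norm q"
    by (elim exE conjE) (rule that)
  note d = d_pos expansion[rule_format, THEN conjunct1] expansion[rule_format, THEN conjunct2]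
  have F_cont: "continuous_on U F"
    by (rule has_derivative_continuous_on, rule has_derivative_at_withinI, rule der)
  have F_int: "(\<lambda>t. F (curve \<eta> t)) integrable_on {0..1}" if "curve \<eta> ` {0..1} \<subseteq> U" for \<eta>
    using that by (intro integrable_continuous_real continuous_on_compose2[OF F_cont] continuous_on_curve)
  have F'_cont: "continuous_on {0..1} (\<lambda>t. F' (curve \<gamma> t))"
    using U(2) by (intro continuous_on_compose2[OF cont] continuous_on_curve)
  have "norm (integral {0..1} (\<lambda>t. F (curve \<eta> t)) - integral {0..1} (\<lambda>t. F (curve \<gamma> t))
      - blinfun_apply (pairing (\<lambda>t. F' (curve \<gamma> t))) (\<eta> - \<gamma>)) \<le> e * norm (\<eta> - \<gamma>)"
    if \<eta>: "norm (\<eta> - \<gamma>) < d / 2" for \<eta>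
  proof -
    have small: "norm (curve (\<eta> - \<gamma>) t) < d" for t
      using norm_curve_le[of "\<eta> - \<gamma>" t] \<eta> by simp
    have sum: "curve \<gamma> t + curve (\<eta> - \<gamma>) t = curve \<eta> t" for t
      by (simp add: curve_diff)
    have \<eta>U: "curve \<eta> ` {0..1} \<subseteq> U"
      using d(2)[OF _ small] sum by (metis image_eqI image_subsetI)
    let ?R = "\<lambda>t. F (curve \<eta> t) - F (curve \<gamma> t) - blinfun_apply (F' (curve \<gamma> t)) (curve (\<eta> - \<gamma>) t)"
    have "norm (?R t) \<le> e * norm (\<eta> - \<gamma>)" if "t \<in> {0..1}" for t
    proof -
      have "norm (?R t) \<le> e / 2 * norm (curve (\<eta> - \<gamma>) t)"
        using d(3)[OF _ small, of "curve \<gamma> t" t] that unfolding sum by simp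
      also have "\<dots> \<le> e / 2 * (2 * norm (\<eta> - \<gamma>))"
        using \<open>0 < e\<close> norm_curve_le by (intro mult_left_mono) auto
      finally show ?thesis
        by simp
    qed
    then have "norm (integral {0..1} ?R) \<le> integral {0..1} (\<lambda>t::real. e * norm (\<eta> - \<gamma>))"
      using F_int[OF \<eta>U] F_int[OF U(2)] pairing_integrable[OF F'_cont]
      by (intro integral_norm_bound_integral integrable_diff) auto
    moreover have "integral {0..1} ?R = integral {0..1} (\<lambda>t. F (curve \<eta> t))
        - integral {0..1} (\<lambda>t. F (curve \<gamma> t)) - blinfun_apply (pairing (\<lambda>t. F' (curve \<gamma> t))) (\<eta> - \<gamma>)"
      using F_int[OF \<eta>U] F_int[OF U(2)] pairing_integrable[OF F'_cont]
      by (simp add: integral_diff integrable_diff pairing_apply[OF F'_cont])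
    ultimately show ?thesis
      by simp
  qed
  then show "\<exists>d>0. \<forall>\<eta>. norm (\<eta> - \<gamma>) < d \<longrightarrow>
      norm (integral {0..1} (\<lambda>t. F (curve \<eta> t)) - integral {0..1} (\<lambda>t. F (curve \<gamma> t))
      - blinfun_apply (pairing (\<lambda>t. F' (curve \<gamma> t))) (\<eta> - \<gamma>)) \<le> e * norm (\<eta> - \<gamma>)"
    using d(1) by (intro exI[of _ "d / 2"]) auto
qed

text \<open>Here the base point enters through a covector field, so the remainder has to be small in
  the operator norm of the dual of the path space; the embedding constant is therefore paid twice.\<close>

lemma superposition_pairing_has_derivative:
  fixes G :: "real \<times> real \<Rightarrow> (real \<times> real) \<Rightarrow>\<^sub>L real"
    and G' :: "real \<times> real \<Rightarrow> (real \<times> real) \<Rightarrow>\<^sub>L (real \<times> real) \<Rightarrow>\<^sub>L real"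
  assumes U: "open U" "curve \<gamma> ` {0..1} \<subseteq> U"
    and der: "\<And>x. x \<in> U \<Longrightarrow> (G has_derivative blinfun_apply (G' x)) (at x)"
    and cont: "continuous_on U G'"
  shows "((\<lambda>\<gamma>. pairing (\<lambda>t. G (curve \<gamma> t))) has_derivative
    (\<lambda>\<eta>. pairing (\<lambda>t. blinfun_apply (G' (curve \<gamma> t)) (curve \<eta> t)))) (at \<gamma>)"
  unfolding has_derivative_at_alt
proof (intro conjI allI impI)
  have G'_cont: "continuous_on {0..1} (\<lambda>t. G' (curve \<gamma> t))"
    using U(2) by (intro continuous_on_compose2[OF cont] continuous_on_curve)
  then have G'_app: "continuous_on {0..1} (\<lambda>t. blinfun_apply (G' (curve \<gamma> t)) (curve \<eta> t))" for \<eta>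
    by (intro continuous_intros)
  obtain M where M: "0 \<le> M" "\<And>t. t \<in> {0..1} \<Longrightarrow> norm (G' (curve \<gamma> t)) \<le> M"
    using continuous_on_unit_interval_bounded[OF G'_cont] by blast
  show "bounded_linear (\<lambda>\<eta>. pairing (\<lambda>t. blinfun_apply (G' (curve \<gamma> t)) (curve \<eta> t)))"
  proof (rule bounded_linear_intro[where K = "4 * M"])
    fix \<eta> \<xi> :: path_space and c :: real
    show "pairing (\<lambda>t. blinfun_apply (G' (curve \<gamma> t)) (curve (\<eta> + \<xi>) t)) =
        pairing (\<lambda>t. blinfun_apply (G' (curve \<gamma> t)) (curve \<eta> t)) + pairing (\<lambda>t. blinfun_apply (G' (curve \<gamma> t)) (curve \<xi> t))"
      by (simp add: curve_add blinfun.add_right pairing_add G'_app)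
    show "pairing (\<lambda>t. blinfun_apply (G' (curve \<gamma> t)) (curve (c *\<^sub>R \<eta>) t)) =
        c *\<^sub>R pairing (\<lambda>t. blinfun_apply (G' (curve \<gamma> t)) (curve \<eta> t))"
      by (simp add: curve_scaleR blinfun.scaleR_right pairing_scaleR G'_app)
    have "norm (blinfun_apply (G' (curve \<gamma> t)) (curve \<eta> t)) \<le> M * (2 * norm \<eta>)" if "t \<in> {0..1}" for t
      using norm_blinfun[of "G' (curve \<gamma> t)" "curve \<eta> t"]
        mult_mono[OF M(2)[OF that] norm_curve_le[of \<eta> t]] M(1)
      by simp
    from norm_pairing_le[OF G'_app this]
    show "norm (pairing (\<lambda>t. blinfun_apply (G' (curve \<gamma> t)) (curve \<eta> t))) \<le> norm \<eta> * (4 * M)"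
      using M(1) by (simp add: mult_ac)
  qed
  fix e :: real assume "0 < e"
  then have "0 < e / 4"
    by simp
  have "\<exists>d>0. \<forall>p\<in>curve \<gamma> ` {0..1}. \<forall>q. norm q < d \<longrightarrow>
      p + q \<in> U \<and> norm (G (p + q) - G p - blinfun_apply (G' p) q) \<le> e / 4 * norm q"
    by (rule uniform_first_order_expansion[OF U(1) compact_curve U(2) der cont \<open>0 < e / 4\<close>])
  then obtain d where d_pos: "0 < d" and expansion: "\<forall>p\<in>curve \<gamma> ` {0..1}. \<forall>q. norm q < d \<longrightarrow>
      p + q \<in> U \<and> norm (G (p + q) - G p - blinfun_apply (G' p) q) \<le> e / 4 * norm q"
    by (elim exE conjE) (rule that)
  note d = d_pos expansion[rule_format, THEN conjunct1] expansion[rule_format, THEN conjunct2]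
  have "continuous_on U G"
    by (rule has_derivative_continuous_on, rule has_derivative_at_withinI, rule der)
  then have G_cont: "continuous_on {0..1} (\<lambda>t. G (curve \<eta> t))" if "curve \<eta> ` {0..1} \<subseteq> U" for \<eta>
    using that by (rule continuous_on_compose2[OF _ continuous_on_curve])
  have "norm (pairing (\<lambda>t. G (curve \<eta> t)) - pairing (\<lambda>t. G (curve \<gamma> t))
      - pairing (\<lambda>t. blinfun_apply (G' (curve \<gamma> t)) (curve (\<eta> - \<gamma>) t))) \<le> e * norm (\<eta> - \<gamma>)"
    if \<eta>: "norm (\<eta> - \<gamma>) < d / 2" for \<eta>
  proof -
    have small: "norm (curve (\<eta> - \<gamma>) t) < d" for t
      using norm_curve_le[of "\<eta> - \<gamma>" t] \<eta> by simp
    have sum: "curve \<gamma> t + curve (\<eta> - \<gamma>) t = curve \<eta> t" for t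
      by (simp add: curve_diff)
    have \<eta>U: "curve \<eta> ` {0..1} \<subseteq> U"
      using d(2)[OF _ small] sum by (metis image_eqI image_subsetI)
    let ?R = "\<lambda>t. G (curve \<eta> t) - G (curve \<gamma> t) - blinfun_apply (G' (curve \<gamma> t)) (curve (\<eta> - \<gamma>) t)"
    have "norm (?R t) \<le> e / 2 * norm (\<eta> - \<gamma>)" if "t \<in> {0..1}" for t
    proof -
      have "norm (?R t) \<le> e / 4 * norm (curve (\<eta> - \<gamma>) t)"
        using d(3)[OF _ small, of "curve \<gamma> t" t] that unfolding sum by simp
      also have "\<dots> \<le> e / 4 * (2 * norm (\<eta> - \<gamma>))"
        using \<open>0 < e\<close> norm_curve_le by (intro mult_left_mono) auto
      finally show ?thesis
        by simp
    qed
    moreover have "continuous_on {0..1} ?R"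
      by (intro continuous_on_diff G_cont \<eta>U U(2) G'_app)
    ultimately have "norm (pairing ?R) \<le> 2 * (e / 2 * norm (\<eta> - \<gamma>))"
      using \<open>0 < e\<close> by (intro norm_pairing_le) auto
    moreover have "pairing ?R = pairing (\<lambda>t. G (curve \<eta> t)) - pairing (\<lambda>t. G (curve \<gamma> t))
      - pairing (\<lambda>t. blinfun_apply (G' (curve \<gamma> t)) (curve (\<eta> - \<gamma>) t))"
      by (simp add: pairing_diff G_cont \<eta>U U(2) G'_app continuous_on_diff)
    ultimately show ?thesis
      by simp
  qed
  then show "\<exists>d>0. \<forall>\<eta>. norm (\<eta> - \<gamma>) < d \<longrightarrow>
      norm (pairing (\<lambda>t. G (curve \<eta> t)) - pairing (\<lambda>t. G (curve \<gamma> t))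
      - pairing (\<lambda>t. blinfun_apply (G' (curve \<gamma> t)) (curve (\<eta> - \<gamma>) t))) \<le> e * norm (\<eta> - \<gamma>)"
    using d(1) by (intro exI[of _ "d / 2"]) auto
qed

lemma eventually_curve_in_open:
  assumes "open U" "curve \<gamma> ` {0..1} \<subseteq> U"
  shows "\<forall>\<^sub>F \<eta> in nhds \<gamma>. curve \<eta> ` {0..1} \<subseteq> U"
proof -
  obtain r where r: "r > 0" "(\<Union>x\<in>curve \<gamma> ` {0..1}. cball x r) \<subseteq> U"
    using compact_subset_open_imp_cball_epsilon_subset[OF compact_curve assms] by blast
  have "curve \<eta> ` {0..1} \<subseteq> U" if "dist \<eta> \<gamma> < r / 2" for \<eta>
  proof (intro image_subsetI)
    fix t :: real assume t: "t \<in> {0..1}"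
    have "curve \<eta> t \<in> cball (curve \<gamma> t) r"
      using norm_curve_le[of "\<eta> - \<gamma>" t] that by (simp add: curve_diff dist_norm norm_minus_commute)
    then show "curve \<eta> t \<in> U"
      using r(2) t by blast
  qed
  then show ?thesis
    unfolding eventually_nhds_metric using r(1) by (intro exI[of _ "r / 2"]) auto
qed

section \<open>First and second derivative of the functional\<close>

lemma I_hat_has_derivative:
  fixes W' :: "real \<times> real \<Rightarrow> (real \<times> real) \<Rightarrow>\<^sub>L real"
  assumes U: "open U" "curve \<gamma> ` {0..1} \<subseteq> U"
    and der: "\<And>x. x \<in> U \<Longrightarrow> ((\<lambda>x. h - (\<phi> \<circ> V) x) has_derivative blinfun_apply (W' x)) (at x)"
    and cont: "continuous_on U W'"
  shows "(B_fun V \<phi> h has_derivative blinfun_apply (pairing (\<lambda>t. W' (curve \<gamma> t)))) (at \<gamma>)" (is ?B)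
    and "(I_hat V \<phi> h has_derivative blinfun_apply (B_fun V \<phi> h \<gamma> *\<^sub>R kinetic.prod_right \<gamma>
      + (A_fun \<gamma> / 2) *\<^sub>R pairing (\<lambda>t. W' (curve \<gamma> t)))) (at \<gamma>)" (is ?I)
proof -
  have "(\<lambda>\<gamma>. integral {0..1} (\<lambda>t. h - (\<phi> \<circ> V) (curve \<gamma> t))) = B_fun V \<phi> h"
    by (simp add: B_fun_def fun_eq_iff)
  then show B: ?B
    using superposition_integral_has_derivative[OF U der cont] by simp
  have "((\<lambda>\<gamma>. 1 / 2 * A_fun \<gamma> * B_fun V \<phi> h \<gamma>) has_derivative
      (\<lambda>\<xi>. 1 / 2 * A_fun \<gamma> * blinfun_apply (pairing (\<lambda>t. W' (curve \<gamma> t))) \<xi>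
        + 1 / 2 * blinfun_apply (2 *\<^sub>R kinetic.prod_right \<gamma>) \<xi> * B_fun V \<phi> h \<gamma>)) (at \<gamma>)"
    by (intro has_derivative_mult has_derivative_mult_right A_fun_has_derivative B)
  then show ?I
    unfolding I_hat_def[abs_def] by (rule has_derivative_eq_rhs)
      (simp add: fun_eq_iff blinfun.add_left blinfun.scaleR_left algebra_simps)
qed

text \<open>The first derivative is computed on a whole neighbourhood of the curve and then differentiated
  once more by the product rule; the two mixed terms coincide on the diagonal.\<close>

lemma second_deriv_I_hat:
  fixes W' :: "real \<times> real \<Rightarrow> (real \<times> real) \<Rightarrow>\<^sub>L real"
    and W'' :: "real \<times> real \<Rightarrow> (real \<times> real) \<Rightarrow>\<^sub>L (real \<times> real) \<Rightarrow>\<^sub>L real"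
  assumes U: "open U" "curve \<gamma> ` {0..1} \<subseteq> U"
    and der: "\<And>x. x \<in> U \<Longrightarrow> ((\<lambda>x. h - (\<phi> \<circ> V) x) has_derivative blinfun_apply (W' x)) (at x)"
    and der2: "\<And>x. x \<in> U \<Longrightarrow> (W' has_derivative blinfun_apply (W'' x)) (at x)"
    and cont: "continuous_on U W''"
  shows "blinfun_apply (second_deriv (I_hat V \<phi> h) \<gamma> \<xi>) \<xi>
    = B_fun V \<phi> h \<gamma> * kinetic \<xi> \<xi>
      + 2 * kinetic \<gamma> \<xi> * blinfun_apply (pairing (\<lambda>t. W' (curve \<gamma> t))) \<xi>
      + A_fun \<gamma> / 2 * integral {0..1}
          (\<lambda>t. blinfun_apply (blinfun_apply (W'' (curve \<gamma> t)) (curve \<xi> t)) (curve \<xi> t))"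
proof -
  have cont': "continuous_on U W'"
    by (rule has_derivative_continuous_on, rule has_derivative_at_withinI, rule der2)
  define P where "P \<eta> = pairing (\<lambda>t. W' (curve \<eta> t))" for \<eta>
  define P' where "P' \<eta> = pairing (\<lambda>t. blinfun_apply (W'' (curve \<gamma> t)) (curve \<eta> t))" for \<eta>
  define DI where "DI \<eta> = B_fun V \<phi> h \<eta> *\<^sub>R kinetic.prod_right \<eta> + (A_fun \<eta> / 2) *\<^sub>R P \<eta>" for \<eta>
  have first: "first_deriv (I_hat V \<phi> h) \<eta> = DI \<eta>" if "curve \<eta> ` {0..1} \<subseteq> U" for \<eta>
    using frechet_derivative_at[OF I_hat_has_derivative(2)[OF U(1) that der cont'], symmetric]
    by (simp add: first_deriv_def blinfun_apply_inverse DI_def P_def)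
  have B: "(B_fun V \<phi> h has_derivative blinfun_apply (P \<gamma>)) (at \<gamma>)"
    unfolding P_def by (rule I_hat_has_derivative(1)[OF U der cont'])
  have A: "((\<lambda>\<eta>. A_fun \<eta> / 2) has_derivative kinetic \<gamma>) (at \<gamma>)"
    using has_derivative_mult_right[OF A_fun_has_derivative, of "1 / 2" \<gamma>]
    by (simp add: blinfun.scaleR_left)
  have K: "(kinetic.prod_right has_derivative kinetic.prod_right) (at \<gamma>)"
    by (rule bounded_linear_imp_has_derivative) (rule kinetic.bounded_linear_prod_right)
  have P: "(P has_derivative P') (at \<gamma>)"
    unfolding P_def[abs_def] P'_def[abs_def]
    by (rule superposition_pairing_has_derivative[OF U der2 cont])
  have "(DI has_derivative (\<lambda>\<xi>. (B_fun V \<phi> h \<gamma> *\<^sub>R kinetic.prod_right \<xi>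
      + blinfun_apply (P \<gamma>) \<xi> *\<^sub>R kinetic.prod_right \<gamma>)
      + ((A_fun \<gamma> / 2) *\<^sub>R P' \<xi> + kinetic \<gamma> \<xi> *\<^sub>R P \<gamma>))) (at \<gamma>)"
    unfolding DI_def[abs_def]
    by (intro has_derivative_add has_derivative_scaleR B A K P)
  moreover have "\<forall>\<^sub>F \<eta> in nhds \<gamma>. DI \<eta> = first_deriv (I_hat V \<phi> h) \<eta>"
    using eventually_curve_in_open[OF U] by eventually_elim (simp add: first)
  ultimately have "(first_deriv (I_hat V \<phi> h) has_derivative (\<lambda>\<xi>. (B_fun V \<phi> h \<gamma> *\<^sub>R kinetic.prod_right \<xi>
      + blinfun_apply (P \<gamma>) \<xi> *\<^sub>R kinetic.prod_right \<gamma>)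
      + ((A_fun \<gamma> / 2) *\<^sub>R P' \<xi> + kinetic \<gamma> \<xi> *\<^sub>R P \<gamma>))) (at \<gamma>)"
    by (rule has_derivative_transform_eventually[OF _ filter_leD[OF at_within_le_nhds]])
      (auto simp: first U(2))
  then have "second_deriv (I_hat V \<phi> h) \<gamma> = (\<lambda>\<xi>. (B_fun V \<phi> h \<gamma> *\<^sub>R kinetic.prod_right \<xi>
      + blinfun_apply (P \<gamma>) \<xi> *\<^sub>R kinetic.prod_right \<gamma>)
      + ((A_fun \<gamma> / 2) *\<^sub>R P' \<xi> + kinetic \<gamma> \<xi> *\<^sub>R P \<gamma>))"
    unfolding second_deriv_def by (rule frechet_derivative_at[symmetric])
  moreover have "continuous_on {0..1} (\<lambda>t. blinfun_apply (W'' (curve \<gamma> t)) (curve \<xi> t))"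
    by (intro blinfun.continuous_on continuous_on_compose2[OF cont] continuous_on_curve U(2))
  ultimately show ?thesis
    by (simp add: blinfun.add_left blinfun.scaleR_left P'_def pairing_apply P_def)
qed

lemma critical_point_I_hat:
  fixes W' :: "real \<times> real \<Rightarrow> (real \<times> real) \<Rightarrow>\<^sub>L real"
  assumes U: "open U" "curve \<gamma> ` {0..1} \<subseteq> U"
    and der: "\<And>x. x \<in> U \<Longrightarrow> ((\<lambda>x. h - (\<phi> \<circ> V) x) has_derivative blinfun_apply (W' x)) (at x)"
    and cont: "continuous_on U W'"
    and crit: "critical_point (I_hat V \<phi> h) \<gamma>"
  shows "B_fun V \<phi> h \<gamma> * kinetic \<gamma> \<xi>
    + A_fun \<gamma> / 2 * blinfun_apply (pairing (\<lambda>t. W' (curve \<gamma> t))) \<xi> = 0"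
proof -
  have "blinfun_apply (B_fun V \<phi> h \<gamma> *\<^sub>R kinetic.prod_right \<gamma>
      + (A_fun \<gamma> / 2) *\<^sub>R pairing (\<lambda>t. W' (curve \<gamma> t))) = (\<lambda>_. 0)"
    using I_hat_has_derivative(2)[OF U der cont] crit unfolding critical_point_def
    by (rule has_derivative_unique)
  from fun_cong[OF this, of \<xi>] show ?thesis
    by (simp add: blinfun.add_left blinfun.scaleR_left)
qed

section \<open>Conservation of energy along planar critical points\<close>

text \<open>Elements of the Sobolev space vanish off the unit interval, so a function is cut off there
  before it represents one.\<close>

definition restrict_h1 :: "(real \<Rightarrow> real) \<Rightarrow> h1" where
  "restrict_h1 u = Abs_h1 (\<lambda>t. if t \<in> {0..1} then u t else 0)"

lemma weak_deriv_cong: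
  assumes "weak_deriv u g" "\<And>t. t \<in> {0..1} \<Longrightarrow> u t = v t"
  shows "weak_deriv v g"
  unfolding weak_deriv_def
proof (intro conjI ballI)
  show "L2 g"
    using assms(1) by (rule weak_derivD(1))
  fix t :: real assume t: "t \<in> {0..1}"
  have "u 0 = v 0"
    by (rule assms(2)) simp
  then show "v t = v 0 + integral {0..t} g"
    using weak_derivD(2)[OF assms(1) t] assms(2)[OF t] by linarith
qed

lemma restrict_h1:
  assumes "weak_deriv u g"
  shows "t \<in> {0..1} \<Longrightarrow> h1_fun (restrict_h1 u) t = u t"
    and "weak_deriv (h1_fun (restrict_h1 u)) g"
proof -
  let ?v = "\<lambda>t. if t \<in> {0..1} then u t else 0"
  have v: "weak_deriv ?v g"
    using assms by (rule weak_deriv_cong) simp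
  then have "?v \<in> h1_set"
    by (auto simp: h1_set_def)
  then have "h1_fun (restrict_h1 u) = ?v"
    unfolding restrict_h1_def by (rule Abs_h1_inverse)
  then show "t \<in> {0..1} \<Longrightarrow> h1_fun (restrict_h1 u) t = u t" "weak_deriv (h1_fun (restrict_h1 u)) g"
    using v by simp_all
qed

lemma weak_deriv_const: "weak_deriv (\<lambda>_. c) (\<lambda>_. 0)"
  by (simp add: weak_deriv_def L2_def)

text \<open>These tent functions are the test functions for the critical point equation: pairing their
  derivative with \<open>r\<^sub>0'\<close> returns \<open>r\<^sub>0(s) - r\<^sub>0(0)\<close>.\<close>

lemma weak_deriv_min:
  assumes "s \<in> {0..1}"
  shows "weak_deriv (\<lambda>t. min t s) (indicator {0..s})"
  unfolding weak_deriv_def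
proof (intro conjI ballI)
  have meas: "(indicator {0..s} :: real \<Rightarrow> real) \<in> borel_measurable (lebesgue_on {0..1})"
    by (rule measurable_restrict_space1, rule borel_measurable_indicator) simp
  have "(\<lambda>t. (indicator {0..s} t :: real)\<^sup>2) = indicator {0..s}"
    by (auto simp: indicator_def fun_eq_iff)
  then show "L2 (indicator {0..s})"
    using assms meas by (auto simp: L2_def integrable_restrict_space indicator_inter_arith[symmetric])
  fix t :: real assume t: "t \<in> {0..1}"
  have "integral {0..t} (indicator {0..s}) = integral ({0..s} \<inter> {0..t}) (\<lambda>_. 1 :: real)"
    by (subst integral_restrict_Int[symmetric]) (auto intro!: integral_cong simp: indicator_def)
  also have "{0..s} \<inter> {0..t} = {0..min t s}"
    by auto
  finally show "min t s = min 0 s + integral {0..t} (indicator {0..s})"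
    using assms t by simp
qed

lemma kinetic_planar: "kinetic (u, 0) (v, 0) = integral {0..1} (\<lambda>t. h1_deriv u t * h1_deriv v t)"
  by (simp add: kinetic_eq inner_prod_def curve_def h10_h1_zero inner_h1_def)

lemma kinetic_planar_weak_deriv:
  assumes "weak_deriv (h1_fun v) g"
  shows "kinetic (u, 0) (v, 0) = integral {0..1} (\<lambda>t. h1_deriv u t * g t)"
  using integral_deriv_cong[OF assms, of "h1_deriv u"] by (simp add: kinetic_planar mult.commute)

text \<open>Testing the critical point equation with the constant \<open>1\<close> and with the functions \<open>t \<mapsto> min t s\<close>
  expresses \<open>r(s)\<close> by integrals of the continuous force \<open>w = W_r(r, 0)\<close>.  Thus \<open>r\<close> is twice
  continuously differentiable with \<open>r'' = - c w\<close> for \<open>c = - A / (2 B)\<close>, and \<open>r'\<^sup>2 / 2 + c W(r, 0)\<close> is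
  constant.  The constant equals its own mean \<open>A / 2 + c B = 0\<close>, which determines the sign of
  \<open>W(r, 0)\<close>.\<close>

lemma planar_energy_nonneg:
  fixes W :: "real \<times> real \<Rightarrow> real" and W' :: "real \<times> real \<Rightarrow> (real \<times> real) \<Rightarrow>\<^sub>L real"
    and r\<^sub>0 :: h1
  defines "r \<equiv> h1_fun r\<^sub>0"
  assumes der: "\<And>t. t \<in> {0..1} \<Longrightarrow> (W has_derivative blinfun_apply (W' (r t, 0))) (at (r t, 0))"
    and cont: "continuous_on {0..1} (\<lambda>t. W' (r t, 0))"
    and B: "B = integral {0..1} (\<lambda>t. W (r t, 0))" "0 < B"
    and A: "A = kinetic (r\<^sub>0, 0) (r\<^sub>0, 0)" "0 < A"
    and crit: "\<And>u. B * kinetic (r\<^sub>0, 0) (u, 0)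
      + A / 2 * integral {0..1} (\<lambda>t. blinfun_apply (W' (r t, 0)) (h1_fun u t, 0)) = 0"
    and t: "t \<in> {0..1}"
  shows "0 \<le> W (r t, 0)"
proof -
  define w where "w t = blinfun_apply (W' (r t, 0)) (1, 0)" for t
  define P where "P s = integral {0..s} w" for s
  define Q where "Q s = integral {0..s} (\<lambda>t. w t * t)" for s
  define c where "c = - A / (2 * B)"
  define p where "p s = - c * P s" for s
  have W'_eq: "blinfun_apply (W' (r t, 0)) (y, 0) = w t * y" for t y
    using blinfun.scaleR_right[of "W' (r t, 0)" y "(1, 0)"] by (simp add: w_def)
  have w_cont: "continuous_on {0..1} w"
    unfolding w_def[abs_def] by (intro blinfun.continuous_on cont continuous_on_const)
  have w_int: "w integrable_on {a..b}" "(\<lambda>t. w t * t) integrable_on {a..b}"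
    if "0 \<le> a" "b \<le> 1" for a b
    using that by (auto intro!: integrable_continuous_real continuous_intros
        intro: continuous_on_subset[OF w_cont])
  have P_der: "(P has_real_derivative w s) (at s within {0..1})"
    and Q_der: "(Q has_real_derivative w s * s) (at s within {0..1})" if "s \<in> {0..1}" for s
    unfolding P_def[abs_def] Q_def[abs_def]
    using that by (auto intro!: integral_has_real_derivative continuous_intros w_cont)
  note one = restrict_h1[OF weak_deriv_const[of 1]]
  have "integral {0..1} (\<lambda>t. blinfun_apply (W' (r t, 0)) (h1_fun (restrict_h1 (\<lambda>_. 1)) t, 0)) = P 1"
    unfolding P_def by (intro integral_cong) (simp add: W'_eq one)
  then have P1: "P 1 = 0"
    using crit[of "restrict_h1 (\<lambda>_. 1)"] kinetic_planar_weak_deriv[OF one(2), of r\<^sub>0] A(2)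
    by simp
  \<comment> \<open>Splitting the test integral at \<open>s\<close> puts it in a form that is differentiable in \<open>s\<close>.\<close>
  have r_eq: "r s = r 0 + c * (Q s - s * P s)" if s: "s \<in> {0..1}" for s
  proof -
    note tent = restrict_h1[OF weak_deriv_min[OF s]]
    have "integral {0..1} (\<lambda>t. h1_deriv r\<^sub>0 t * indicator {0..s} t)
        = integral {0..1} (\<lambda>t. if t \<in> {0..s} then h1_deriv r\<^sub>0 t else 0)"
      by (intro integral_cong) (simp add: indicator_def)
    also have "\<dots> = integral ({0..s} \<inter> {0..1}) (h1_deriv r\<^sub>0)"
      by (rule integral_restrict_Int)
    also have "{0..s} \<inter> {0..1} = {0..s}"
      using s by auto
    finally have kin: "kinetic (r\<^sub>0, 0) (restrict_h1 (\<lambda>t. min t s), 0) = r s - r 0"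
      using weak_derivD(2)[OF weak_deriv_h1_deriv[of r\<^sub>0] s] kinetic_planar_weak_deriv[OF tent(2), of r\<^sub>0]
      by (simp add: r_def)
    have "integral {0..1} (\<lambda>t. blinfun_apply (W' (r t, 0)) (h1_fun (restrict_h1 (\<lambda>t. min t s)) t, 0))
        = integral {0..1} (\<lambda>t. w t * min t s)"
      by (intro integral_cong) (simp add: W'_eq tent)
    also have "\<dots> = integral {0..s} (\<lambda>t. w t * min t s) + integral {s..1} (\<lambda>t. w t * min t s)"
      using s by (intro Henstock_Kurzweil_Integration.integral_combine[symmetric]
          integrable_continuous_real continuous_intros w_cont) auto
    also have "integral {0..s} (\<lambda>t. w t * min t s) = Q s"
      unfolding Q_def by (intro integral_cong) simp
    also have "integral {s..1} (\<lambda>t. w t * min t s) = integral {s..1} (\<lambda>t. w t * s)"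
      by (intro integral_cong) simp
    also have "\<dots> = s * (P 1 - P s)"
      using s w_int(1)[of 0 1] Henstock_Kurzweil_Integration.integral_combine[of 0 s 1 w]
      by (auto simp: P_def)
    finally have "B * (r s - r 0) + A / 2 * (Q s - s * P s) = 0"
      using crit[of "restrict_h1 (\<lambda>t. min t s)"] kin P1 by simp
    then show ?thesis
      using B(2) by (simp add: c_def field_simps)
  qed
  \<comment> \<open>The two terms \<open>s * w s\<close> that arise from \<open>Q s\<close> and from \<open>s * P s\<close> cancel, so \<open>r'\<close> is again
     differentiable.\<close>
  have r_der: "(r has_real_derivative p s) (at s within {0..1})" if s: "s \<in> {0..1}" for s
  proof -
    have "((\<lambda>s. r 0 + c * (Q s - s * P s)) has_real_derivative p s) (at s within {0..1})"
      using P_der[OF s] Q_der[OF s] by (auto intro!: derivative_eq_intros simp: p_def algebra_simps)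
    then show ?thesis
      by (rule has_field_derivative_transform_within[OF _ zero_less_one s]) (rule r_eq[symmetric])
  qed
  have p_der: "(p has_real_derivative - c * w s) (at s within {0..1})" if "s \<in> {0..1}" for s
    unfolding p_def[abs_def] using P_der[OF that] by (auto intro!: derivative_eq_intros)
  have p_cont: "continuous_on {0..1} p"
    using p_der by (rule DERIV_continuous_on)
  \<comment> \<open>The kinetic form refers to an arbitrary weak derivative of \<open>r\<close>; uniqueness of weak derivatives
     identifies it with \<open>p\<close>.\<close>
  have "weak_deriv r p"
    unfolding weak_deriv_def
  proof (intro conjI ballI)
    fix s :: real assume s: "s \<in> {0..1}"
    have "(p has_integral r s - r 0) {0..s}"
    proof (rule fundamental_theorem_of_calculus)
      fix x assume "x \<in> {0..s}"
      then show "(r has_vector_derivative p x) (at x within {0..s})"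
        using s r_der[of x]
        by (auto simp: has_real_derivative_iff_has_vector_derivative
            intro: has_vector_derivative_within_subset)
    qed (use s in simp)
    then show "r s = r 0 + integral {0..s} p"
      by (simp add: integral_unique)
  qed (rule L2_continuous[OF p_cont])
  then have rp: "weak_deriv (h1_fun r\<^sub>0) p"
    by (simp add: r_def)
  have A_eq: "A = integral {0..1} (\<lambda>t. (p t)\<^sup>2)"
    using kinetic_planar_weak_deriv[OF rp, of r\<^sub>0] integral_deriv_cong[OF rp, of p]
    by (simp add: A(1) power2_eq_square)
  have W_der: "((\<lambda>t. W (r t, 0)) has_real_derivative w s * p s) (at s within {0..1})"
    if s: "s \<in> {0..1}" for s
  proof -
    have "((\<lambda>t. (r t, 0 :: real)) has_derivative (\<lambda>y. (p s * y, 0))) (at s within {0..1})"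
      using r_der[OF s] unfolding has_field_derivative_def
      by (intro has_derivative_Pair has_derivative_const)
    from has_derivative_compose[OF this der[OF s]] show ?thesis
      unfolding has_field_derivative_def by (rule has_derivative_eq_rhs) (simp add: W'_eq fun_eq_iff)
  qed
  have W_cont: "continuous_on {0..1} (\<lambda>t. W (r t, 0))"
    using W_der by (rule DERIV_continuous_on)
  have "((\<lambda>t. (p t)\<^sup>2 / 2 + c * W (r t, 0)) has_real_derivative 0) (at s within {0..1})"
    if s: "s \<in> {0..1}" for s
    using p_der[OF s] W_der[OF s] by (auto intro!: derivative_eq_intros)
  then obtain E where E: "\<And>s. s \<in> {0..1} \<Longrightarrow> (p s)\<^sup>2 / 2 + c * W (r s, 0) = E"
    using has_field_derivative_zero_constant[of "{0..1}" "\<lambda>t. (p t)\<^sup>2 / 2 + c * W (r t, 0)"] by auto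
  have "integral {0..1} (\<lambda>t. (p t)\<^sup>2 / 2 + c * W (r t, 0)) = integral {0..1} (\<lambda>_::real. E)"
    by (intro integral_cong E)
  then have "E = integral {0..1} (\<lambda>t. (p t)\<^sup>2 / 2 + c * W (r t, 0))"
    by simp
  also have "\<dots> = A / 2 + c * B"
    unfolding A_eq B(1)
    by (subst integral_add) (auto intro!: integrable_continuous_real continuous_intros p_cont W_cont)
  also have "\<dots> = 0"
    using B(2) by (simp add: c_def)
  finally have "A * W (r t, 0) = B * (p t)\<^sup>2"
    using E[OF t] B(2) by (simp add: c_def field_simps)
  then show ?thesis
    using A(2) B(2) by (metis mult_nonneg_nonneg zero_le_power2 less_imp_le zero_le_mult_iff not_less)
qed

section \<open>The potential near the critical point\<close>

lemma C2_onD: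
  assumes "C2_on f S"
  obtains f' f'' where "\<And>x. x \<in> S \<Longrightarrow> (f has_derivative blinfun_apply (f' x)) (at x)"
    "\<And>x. x \<in> S \<Longrightarrow> (f' has_derivative blinfun_apply (f'' x)) (at x)"
    "continuous_on S f''"
  using assms unfolding C2_on_def by blast

lemma open_half_plane: "open half_plane"
proof -
  have "half_plane = {0<..} \<times> UNIV"
    by (auto simp: half_plane_def)
  then show ?thesis
    by (metis open_Times open_greaterThan open_UNIV)
qed

lemma V_rr_eq_second_derivative:
  fixes V' :: "real \<times> real \<Rightarrow> (real \<times> real) \<Rightarrow>\<^sub>L real"
    and V'' :: "real \<times> real \<Rightarrow> (real \<times> real) \<Rightarrow>\<^sub>L (real \<times> real) \<Rightarrow>\<^sub>L real"
  assumes V': "\<And>x. x \<in> half_plane \<Longrightarrow> (V has_derivative blinfun_apply (V' x)) (at x)"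
    and V'': "\<And>x. x \<in> half_plane \<Longrightarrow> (V' has_derivative blinfun_apply (V'' x)) (at x)"
    and "0 < r"
  shows "V_rr V r z = blinfun_apply (blinfun_apply (V'' (r, z)) (1, 0)) (1, 0)"
proof -
  have path: "((\<lambda>\<rho>. (\<rho>, z)) has_derivative (\<lambda>y. (y, 0))) (at \<rho>)" for \<rho> :: real
    by (intro has_derivative_Pair has_derivative_ident has_derivative_const)
  have scale: "blinfun_apply f (y, 0) = blinfun_apply f (1, 0) * y"
    for f :: "(real \<times> real) \<Rightarrow>\<^sub>L real" and y
    using blinfun.scaleR_right[of f y "(1, 0)"] by simp
  have first: "deriv (\<lambda>\<rho>. V (\<rho>, z)) \<rho> = blinfun_apply (V' (\<rho>, z)) (1, 0)" if "0 < \<rho>" for \<rho>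
  proof (rule DERIV_imp_deriv)
    show "((\<lambda>\<rho>. V (\<rho>, z)) has_real_derivative blinfun_apply (V' (\<rho>, z)) (1, 0)) (at \<rho>)"
      unfolding has_field_derivative_def
      using that by (intro has_derivative_eq_rhs[OF has_derivative_compose[OF path V'] ext[OF scale]])
        (simp add: half_plane_def)
  qed
  have "((\<lambda>\<rho>. V' (\<rho>, z)) has_derivative (\<lambda>y. blinfun_apply (V'' (r, z)) (y, 0))) (at r)"
    using has_derivative_compose[OF path V''[of "(r, z)"]] \<open>0 < r\<close> by (simp add: half_plane_def)
  then have "((\<lambda>\<rho>. blinfun_apply (V' (\<rho>, z)) (1, 0)) has_derivative
      (\<lambda>y. blinfun_apply (blinfun_apply (V'' (r, z)) (y, 0)) (1, 0))) (at r)"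
    by (rule bounded_linear.has_derivative[OF blinfun.bounded_linear_left])
  moreover have "blinfun_apply (blinfun_apply (V'' (r, z)) (y, 0)) (1, 0)
      = blinfun_apply (blinfun_apply (V'' (r, z)) (1, 0)) (1, 0) * y" for y
    using blinfun.scaleR_right[of "V'' (r, z)" y "(1, 0)"] by (simp add: blinfun.scaleR_left)
  ultimately have second: "((\<lambda>\<rho>. blinfun_apply (V' (\<rho>, z)) (1, 0)) has_real_derivative
      blinfun_apply (blinfun_apply (V'' (r, z)) (1, 0)) (1, 0)) (at r)"
    unfolding has_field_derivative_def by (rule has_derivative_eq_rhs[OF _ ext])
  have "\<forall>\<^sub>F \<rho> in nhds r. 0 < \<rho>"
    using \<open>0 < r\<close> eventually_nhds_in_open[of "{0<..}" r] by simp
  then have "\<forall>\<^sub>F \<rho> in nhds r. deriv (\<lambda>\<rho>. V (\<rho>, z)) \<rho> = blinfun_apply (V' (\<rho>, z)) (1, 0)"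
    by eventually_elim (rule first)
  then have "V_rr V r z = deriv (\<lambda>\<rho>. blinfun_apply (V' (\<rho>, z)) (1, 0)) r"
    unfolding V_rr_def by (intro deriv_cong_ev) auto
  then show ?thesis
    using DERIV_imp_deriv[OF second] by simp
qed

text \<open>On the interior of a Hill region of regular energy the inequality is strict because the whole
  level set is its frontier; this keeps \<open>V\<close> inside the interval on which the cut-off is smooth.\<close>

lemma interior_hill_below:
  assumes "V3 V hm hp" "hm < e" "e < hp" "x \<in> interior (hill V e)"
  shows "x \<in> half_plane" "V x < e"
proof -
  have x: "x \<in> hill V e"
    using assms(4) interior_subset by blast
  then show "x \<in> half_plane"
    by (simp add: hill_def)
  have "frontier (hill V e) = {p \<in> half_plane. V p = e}"
    using assms(1-3) unfolding V3_def by blast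
  moreover have "x \<notin> frontier (hill V e)"
    using assms(4) by (simp add: frontier_def)
  ultimately show "V x < e"
    using x by (auto simp: hill_def)
qed

lemma admissible_cutoff_derivative:
  assumes "admissible_cutoff \<phi> h \<epsilon>"
  shows "\<tau> < h + 2 * \<epsilon> \<Longrightarrow> (\<phi> has_real_derivative deriv \<phi> \<tau>) (at \<tau>)"
    and "continuous_on {..<h + 2 * \<epsilon>} (deriv \<phi>)"
proof -
  have smooth: "(deriv ^^ n) \<phi> differentiable (at \<tau>)" if "\<tau> < h + 2 * \<epsilon>" for n \<tau>
    using assms that unfolding admissible_cutoff_def smooth_on_reals_def by blast
  show "\<tau> < h + 2 * \<epsilon> \<Longrightarrow> (\<phi> has_real_derivative deriv \<phi> \<tau>) (at \<tau>)"
    using smooth[of \<tau> 0] by (simp add: DERIV_deriv_iff_real_differentiable)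
  show "continuous_on {..<h + 2 * \<epsilon>} (deriv \<phi>)"
    using smooth[of _ 1] by (intro continuous_at_imp_continuous_on)
      (auto intro: differentiable_imp_continuous_within)
qed

lemma admissible_cutoff_le_iff:
  assumes "admissible_cutoff \<phi> h \<epsilon>" "0 < \<epsilon>" "\<tau> < h + 2 * \<epsilon>" "\<phi> \<tau> \<le> h"
  shows "\<tau> \<le> h"
proof (rule ccontr)
  assume "\<not> \<tau> \<le> h"
  then have "h < \<tau>"
    by simp
  then have "\<phi> h < \<phi> \<tau>"
  proof (rule DERIV_pos_imp_increasing)
    fix x assume "h \<le> x" "x \<le> \<tau>"
    then have x: "x < h + 2 * \<epsilon>"
      using assms(3) by simp
    then have "1 \<le> deriv \<phi> x"
      using assms(1) unfolding admissible_cutoff_def by blast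
    then show "\<exists>y. (\<phi> has_real_derivative y) (at x) \<and> 0 < y"
      using admissible_cutoff_derivative(1)[OF assms(1) x] by (intro exI[of _ "deriv \<phi> x"]) simp
  qed
  moreover have "\<phi> h = h"
    using assms(1,2) unfolding admissible_cutoff_def by simp
  ultimately show False
    using assms(4) by simp
qed

text \<open>The energy argument is applied to \<open>W = h - \<phi> \<circ> V\<close>, and the result is transferred from \<open>\<phi> \<circ> V\<close> to
  \<open>V\<close> because \<open>\<phi>\<close> is strictly increasing and fixes \<open>h\<close>.\<close>

lemma critical_planar_in_hill:
  assumes V: "C2_on V half_plane" and V3: "V3 V hm hp"
    and \<epsilon>: "hm < h" "0 < \<epsilon>" "h + 2 * \<epsilon> < hp"
    and \<phi>: "admissible_cutoff \<phi> h \<epsilon>"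
    and \<gamma>: "\<gamma> = (r\<^sub>0, 0)" "\<gamma> \<in> Gamma_hat V h \<epsilon>"
    and crit: "critical_point (I_hat V \<phi> h) \<gamma>"
    and pos: "0 < A_fun \<gamma>" "0 < B_fun V \<phi> h \<gamma>"
    and t: "t \<in> {0..1}"
  shows "curve \<gamma> t \<in> half_plane" "V (curve \<gamma> t) \<le> h"
proof -
  obtain V' V'' where V': "\<And>x. x \<in> half_plane \<Longrightarrow> (V has_derivative blinfun_apply (V' x)) (at x)"
    and V'': "\<And>x. x \<in> half_plane \<Longrightarrow> (V' has_derivative blinfun_apply (V'' x)) (at x)"
    using C2_onD[OF V] by metis
  define U where "U = interior (hill V (h + 2 * \<epsilon>))"
  define W' where "W' x = - (deriv \<phi> (V x) *\<^sub>R V' x)" for x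
  have U: "open U" "curve \<gamma> ` {0..1} \<subseteq> U"
    using \<gamma>(2) by (auto simp: U_def Gamma_hat_def)
  have below: "x \<in> half_plane" "V x < h + 2 * \<epsilon>" if "x \<in> U" for x
    using interior_hill_below[OF V3 _ \<epsilon>(3)] that \<epsilon>(1,2) unfolding U_def by auto
  have der: "((\<lambda>x. h - (\<phi> \<circ> V) x) has_derivative blinfun_apply (W' x)) (at x)" if "x \<in> U" for x
  proof -
    have "((\<lambda>x. \<phi> (V x)) has_derivative (\<lambda>y. deriv \<phi> (V x) * blinfun_apply (V' x) y)) (at x)"
      using has_derivative_compose[OF V'[OF below(1)[OF that]]
          admissible_cutoff_derivative(1)[OF \<phi> below(2)[OF that], unfolded has_field_derivative_def]] .
    from has_derivative_diff[OF has_derivative_const[of h] this]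
    show ?thesis
      unfolding comp_def by (rule has_derivative_eq_rhs)
        (simp add: W'_def fun_eq_iff blinfun.minus_left blinfun.scaleR_left)
  qed
  have "continuous_on half_plane V"
    by (rule has_derivative_continuous_on, rule has_derivative_at_withinI, rule V')
  moreover have "continuous_on half_plane V'"
    by (rule has_derivative_continuous_on, rule has_derivative_at_withinI, rule V'')
  ultimately have "continuous_on U V" "continuous_on U V'"
    using below(1) by (auto intro: continuous_on_subset)
  then have cont: "continuous_on U W'"
    unfolding W'_def[abs_def] using below(2)
    by (intro continuous_intros continuous_on_compose2[OF admissible_cutoff_derivative(2)[OF \<phi>]]) auto
  show hp: "curve \<gamma> t \<in> half_plane"
    using below(1) U(2) t by blast
  have curve: "curve \<gamma> s = (h1_fun r\<^sub>0 s, 0)" for s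
    by (simp add: \<gamma>(1) curve_def h10_h1_zero)
  have cont\<gamma>: "continuous_on {0..1} (\<lambda>t. W' (curve \<gamma> t))"
    by (intro continuous_on_compose2[OF cont] continuous_on_curve U(2))
  have "0 \<le> h - (\<phi> \<circ> V) (h1_fun r\<^sub>0 t, 0)"
  proof (rule planar_energy_nonneg[where W' = W'])
    show "((\<lambda>x. h - (\<phi> \<circ> V) x) has_derivative blinfun_apply (W' (h1_fun r\<^sub>0 t, 0))) (at (h1_fun r\<^sub>0 t, 0))"
      if "t \<in> {0..1}" for t
    proof -
      have "curve \<gamma> t \<in> U"
        using that U(2) by blast
      from der[OF this] show ?thesis
        by (simp add: curve)
    qed
    show "continuous_on {0..1} (\<lambda>t. W' (h1_fun r\<^sub>0 t, 0))"
      using cont\<gamma> by (simp add: curve)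
    show "B_fun V \<phi> h \<gamma> = integral {0..1} (\<lambda>t. h - (\<phi> \<circ> V) (h1_fun r\<^sub>0 t, 0))"
      by (simp add: B_fun_def curve)
    show "A_fun \<gamma> = kinetic (r\<^sub>0, 0) (r\<^sub>0, 0)"
      by (simp add: A_fun_eq_kinetic \<gamma>(1))
    show "B_fun V \<phi> h \<gamma> * kinetic (r\<^sub>0, 0) (u, 0)
        + A_fun \<gamma> / 2 * integral {0..1} (\<lambda>t. blinfun_apply (W' (h1_fun r\<^sub>0 t, 0)) (h1_fun u t, 0)) = 0" for u
      using critical_point_I_hat[OF U der cont crit, of "(u, 0)"]
      unfolding pairing_apply[OF cont\<gamma>] by (simp add: curve) (simp add: \<gamma>(1) curve_def h10_h1_zero)
  qed (use pos t in auto)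
  then have "\<phi> (V (curve \<gamma> t)) \<le> h"
    by (simp add: curve)
  moreover have "V (curve \<gamma> t) < h + 2 * \<epsilon>"
    using below(2) U(2) t by blast
  ultimately show "V (curve \<gamma> t) \<le> h"
    using admissible_cutoff_le_iff[OF \<phi> \<epsilon>(2)] by blast
qed

section \<open>The Hessian on constants and radial dilations\<close>

definition one_h1 :: h1 where
  "one_h1 = restrict_h1 (\<lambda>_. 1)"

lemma one_h1_fun: "t \<in> {0..1} \<Longrightarrow> h1_fun one_h1 t = 1"
  and one_h1_weak_deriv: "weak_deriv (h1_fun one_h1) (\<lambda>_. 0)"
  unfolding one_h1_def using restrict_h1[OF weak_deriv_const[of 1]] by simp_all

lemma kinetic_one: "kinetic (u, 0) (one_h1, 0) = 0"
  using kinetic_planar_weak_deriv[OF one_h1_weak_deriv, of u] by simp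

text \<open>Since the curve stays in \<open>{V \<le> h}\<close>, the neighbourhood \<open>{V < h + \<epsilon>}\<close> may be used for all
  derivatives.  There \<open>\<phi> \<circ> V = V\<close>, so only the second derivative of \<open>V\<close> itself enters.\<close>

lemma second_deriv_constants_dilations:
  fixes V :: "real \<times> real \<Rightarrow> real" and a b :: real
  assumes V: "C2_on V half_plane" and V3: "V3 V hm hp"
    and \<epsilon>: "hm < h" "0 < \<epsilon>" "h + 2 * \<epsilon> < hp"
    and \<phi>: "admissible_cutoff \<phi> h \<epsilon>"
    and \<gamma>: "\<gamma> = (r\<^sub>0, 0)" "\<gamma> \<in> Gamma_hat V h \<epsilon>"
    and crit: "critical_point (I_hat V \<phi> h) \<gamma>"
    and pos: "0 < A_fun \<gamma>" "0 < B_fun V \<phi> h \<gamma>"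
  defines "\<xi> \<equiv> (a *\<^sub>R one_h1 + b *\<^sub>R r\<^sub>0, 0)"
  shows "blinfun_apply (second_deriv (I_hat V \<phi> h) \<gamma> \<xi>) \<xi>
    = - A_fun \<gamma> / 2 * (6 * b\<^sup>2 * B_fun V \<phi> h \<gamma>
        + (a\<^sup>2 * I_0 V r\<^sub>0 + 2 * a * b * I_1 V r\<^sub>0 + b\<^sup>2 * I_2 V r\<^sub>0))"
proof -
  obtain V' V'' where V': "\<And>x. x \<in> half_plane \<Longrightarrow> (V has_derivative blinfun_apply (V' x)) (at x)"
    and V'': "\<And>x. x \<in> half_plane \<Longrightarrow> (V' has_derivative blinfun_apply (V'' x)) (at x)"
    and V''_cont: "continuous_on half_plane V''"
    using C2_onD[OF V] by metis
  have V_cont: "continuous_on half_plane V"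
    by (rule has_derivative_continuous_on, rule has_derivative_at_withinI, rule V')
  have V'_cont: "continuous_on half_plane V'"
    by (rule has_derivative_continuous_on, rule has_derivative_at_withinI, rule V'')
  define U where "U = half_plane \<inter> V -` {..<h + \<epsilon>}"
  have U_open: "open U"
    unfolding U_def by (rule continuous_open_preimage[OF V_cont open_half_plane]) simp
  have U_half: "U \<subseteq> half_plane"
    by (auto simp: U_def)
  note hill = critical_planar_in_hill[OF V V3 \<epsilon> \<phi> \<gamma> crit pos]
  have U_curve: "curve \<gamma> ` {0..1} \<subseteq> U"
    using hill \<epsilon>(2) by (fastforce simp: U_def)
  have \<phi>_id: "\<phi> \<tau> = \<tau>" if "\<tau> \<le> h + \<epsilon>" for \<tau>
    using \<phi> that unfolding admissible_cutoff_def by blast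
  have der: "((\<lambda>x. h - (\<phi> \<circ> V) x) has_derivative blinfun_apply (- V' x)) (at x)" if x: "x \<in> U" for x
  proof (rule has_derivative_transform_within_open[OF _ U_open x])
    show "((\<lambda>x. h - V x) has_derivative blinfun_apply (- V' x)) (at x)"
      using has_derivative_diff[OF has_derivative_const[of h] V'[of x]] x U_half
      by (auto simp: uminus_blinfun.rep_eq fun_Compl_def)
  qed (simp add: U_def \<phi>_id)
  have der2: "((\<lambda>x. - V' x) has_derivative blinfun_apply (- V'' x)) (at x)" if "x \<in> U" for x
    using has_derivative_minus[OF V''[of x]] that U_half
    by (auto simp: uminus_blinfun.rep_eq fun_Compl_def)
  have cont: "continuous_on U (\<lambda>x. - V' x)" and cont2: "continuous_on U (\<lambda>x. - V'' x)"
    using V'_cont V''_cont U_half by (auto intro!: continuous_on_minus intro: continuous_on_subset)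
  define D where "D = pairing (\<lambda>t. - V' (curve \<gamma> t))"
  have EL: "B_fun V \<phi> h \<gamma> * kinetic \<gamma> \<eta> + A_fun \<gamma> / 2 * blinfun_apply D \<eta> = 0" for \<eta>
    unfolding D_def by (rule critical_point_I_hat[OF U_open U_curve der cont crit])
  have \<xi>: "\<xi> = a *\<^sub>R (one_h1, 0) + b *\<^sub>R \<gamma>"
    by (simp add: \<xi>_def \<gamma>(1))
  have kin1: "kinetic \<gamma> \<xi> = b * A_fun \<gamma>"
    using kinetic_one[of r\<^sub>0]
    by (simp add: \<xi> kinetic.add_right kinetic.scaleR_right A_fun_eq_kinetic \<gamma>(1) del: scaleR_Pair)
  have "kinetic \<xi> \<xi> = a * kinetic \<xi> (one_h1, 0) + b * kinetic \<gamma> \<xi>"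
    by (subst (2) \<xi>) (simp add: kinetic.add_right kinetic.scaleR_right kinetic_sym[of \<xi> \<gamma>]
        del: scaleR_Pair)
  moreover have "kinetic \<xi> (one_h1, 0) = 0"
    unfolding \<xi>_def by (rule kinetic_one)
  ultimately have kin2: "kinetic \<xi> \<xi> = b\<^sup>2 * A_fun \<gamma>"
    by (simp add: kin1 power2_eq_square)
  \<comment> \<open>Criticality turns the first variation of \<open>B\<close> into a multiple of \<open>B\<close>; this produces the
     coefficient \<open>6\<close>, as \<open>A'' B + 2 A' B' = 2 b\<^sup>2 A B - 8 b\<^sup>2 A B = - 6 b\<^sup>2 A B\<close>.\<close>
  have D: "blinfun_apply D \<xi> = - 2 * b * B_fun V \<phi> h \<gamma>"
  proof -
    have "A_fun \<gamma> * (blinfun_apply D \<xi> + 2 * b * B_fun V \<phi> h \<gamma>) = 0"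
      using EL[of \<xi>] by (simp add: kin1 algebra_simps)
    then show ?thesis
      using pos(1) by simp
  qed
  have curve: "curve \<gamma> t = (h1_fun r\<^sub>0 t, 0)" for t
    by (simp add: \<gamma>(1) curve_def h10_h1_zero)
  define v where "v t = V_rr V (h1_fun r\<^sub>0 t) 0" for t
  have v: "v t = blinfun_apply (blinfun_apply (V'' (curve \<gamma> t)) (1, 0)) (1, 0)" if "t \<in> {0..1}" for t
    using V_rr_eq_second_derivative[OF V' V'', of "h1_fun r\<^sub>0 t" 0] hill(1)[OF that]
    by (simp add: v_def curve half_plane_def)
  have "continuous_on {0..1} (\<lambda>t. blinfun_apply (blinfun_apply (V'' (curve \<gamma> t)) (1, 0)) (1, 0))"
    using U_curve U_half
    by (intro blinfun.continuous_on continuous_on_compose2[OF V''_cont] continuous_on_curve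
        continuous_on_const) auto
  then have v_cont: "continuous_on {0..1} v"
    by (rule continuous_on_eq) (simp add: v)
  have "integral {0..1} (\<lambda>t. blinfun_apply (blinfun_apply (- V'' (curve \<gamma> t)) (curve \<xi> t)) (curve \<xi> t))
      = integral {0..1} (\<lambda>t. - (a\<^sup>2 * v t + 2 * a * b * (v t * h1_fun r\<^sub>0 t) + b\<^sup>2 * (v t * (h1_fun r\<^sub>0 t)\<^sup>2)))"
  proof (rule integral_cong)
    fix t :: real assume t: "t \<in> {0..1}"
    have "curve \<xi> t = (a + b * h1_fun r\<^sub>0 t) *\<^sub>R (1, 0)"
      using t by (simp add: \<xi>_def curve_def h10_h1_zero one_h1_fun)
    then show "blinfun_apply (blinfun_apply (- V'' (curve \<gamma> t)) (curve \<xi> t)) (curve \<xi> t)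
        = - (a\<^sup>2 * v t + 2 * a * b * (v t * h1_fun r\<^sub>0 t) + b\<^sup>2 * (v t * (h1_fun r\<^sub>0 t)\<^sup>2))"
      by (simp only: blinfun.scaleR_right blinfun.scaleR_left blinfun.minus_left v[OF t])
        (simp add: power2_eq_square algebra_simps)
  qed
  also have "\<dots> = - (a\<^sup>2 * I_0 V r\<^sub>0 + 2 * a * b * I_1 V r\<^sub>0 + b\<^sup>2 * I_2 V r\<^sub>0)"
  proof -
    have "(v has_integral I_0 V r\<^sub>0) {0..1}"
      "((\<lambda>t. v t * h1_fun r\<^sub>0 t) has_integral I_1 V r\<^sub>0) {0..1}"
      "((\<lambda>t. v t * (h1_fun r\<^sub>0 t)\<^sup>2) has_integral I_2 V r\<^sub>0) {0..1}"
      unfolding I_0_def I_1_def I_2_def v_def[symmetric]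
      by (intro integrable_integral integrable_continuous_real continuous_intros v_cont
          continuous_on_h1_fun)+
    then show ?thesis
      by (intro integral_unique has_integral_neg has_integral_add has_integral_mult_right)
  qed
  finally have hess: "integral {0..1}
      (\<lambda>t. blinfun_apply (blinfun_apply (- V'' (curve \<gamma> t)) (curve \<xi> t)) (curve \<xi> t))
      = - (a\<^sup>2 * I_0 V r\<^sub>0 + 2 * a * b * I_1 V r\<^sub>0 + b\<^sup>2 * I_2 V r\<^sub>0)" .
  have "blinfun_apply (second_deriv (I_hat V \<phi> h) \<gamma> \<xi>) \<xi>
    = B_fun V \<phi> h \<gamma> * kinetic \<xi> \<xi> + 2 * kinetic \<gamma> \<xi> * blinfun_apply D \<xi>
      + A_fun \<gamma> / 2 * integral {0..1}
          (\<lambda>t. blinfun_apply (blinfun_apply (- V'' (curve \<gamma> t)) (curve \<xi> t)) (curve \<xi> t))"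
    unfolding D_def by (rule second_deriv_I_hat[OF U_open U_curve der der2 cont2])
  then show ?thesis
    unfolding hess kin1 kin2 D
    by (simp add: power2_eq_square algebra_simps)
qed

lemma quadratic_form_pos:
  fixes a b I\<^sub>0 I\<^sub>1 K :: real
  assumes "0 < I\<^sub>0" "0 < I\<^sub>0 * K - I\<^sub>1\<^sup>2" "a \<noteq> 0 \<or> b \<noteq> 0"
  shows "0 < a\<^sup>2 * I\<^sub>0 + 2 * a * b * I\<^sub>1 + b\<^sup>2 * K"
proof -
  have "I\<^sub>0 * (a\<^sup>2 * I\<^sub>0 + 2 * a * b * I\<^sub>1 + b\<^sup>2 * K) = (a * I\<^sub>0 + b * I\<^sub>1)\<^sup>2 + b\<^sup>2 * (I\<^sub>0 * K - I\<^sub>1\<^sup>2)"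
    by (simp add: power2_eq_square algebra_simps)
  also have "\<dots> > 0"
  proof (cases "b = 0")
    case True
    then show ?thesis
      using assms by simp
  next
    case False
    then show ?thesis
      using assms(2) by (intro add_nonneg_pos) auto
  qed
  finally show ?thesis
    using assms(1) by (simp add: zero_less_mult_iff)
qed

lemma morse_index_on_ge:
  assumes "subspace S" "S \<subseteq> W" "finite b" "span b = S"
    and "\<And>v. v \<in> S \<Longrightarrow> v \<noteq> 0 \<Longrightarrow> blinfun_apply (second_deriv f x v) v < 0"
  shows "enat (dim S) \<le> morse_index_on W f x"
  unfolding morse_index_on_def using assms by (intro Sup_upper) blast

theorem lemma3p2:
  fixes V V0 :: "real \<times> real \<Rightarrow> real" and \<phi> :: "real \<Rightarrow> real"
    and \<omega> hm hp h \<epsilon> :: real and r\<^sub>0 :: h1 and \<gamma>\<^sub>0 :: path_space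
  assumes "0 < \<omega>"
    and "\<And>r z. 0 < r \<Longrightarrow> V (r, z) = \<omega>\<^sup>2 / (2 * r\<^sup>2) + V0 (r, z)"
    and V1: "C2_on V half_plane"
    and V2: "\<And>r z. 0 < r \<Longrightarrow> V (r, z) = V (r, - z)"
    and V3: "V3 V hm hp"
    and h: "hm < h" "h < hp"
    and \<epsilon>: "0 < \<epsilon>" "upper_graph V (h + 2 * \<epsilon>)" "h + 2 * \<epsilon> < hp"
      "\<And>p. p \<in> half_plane \<Longrightarrow> V p \<in> {h..h + 2 * \<epsilon>} \<Longrightarrow> grad V p \<noteq> 0"
      "4 / \<epsilon>\<^sup>2 > h + 3 * \<epsilon> / 2"
    and \<phi>: "admissible_cutoff \<phi> h \<epsilon>"
    and planar: "\<gamma>\<^sub>0 = (r\<^sub>0, 0)"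
    and "\<gamma>\<^sub>0 \<in> Gamma_hat V h \<epsilon>"
    and "\<not> (\<exists>c. \<forall>t\<in>{0..1}. curve \<gamma>\<^sub>0 t = c)"
    and crit: "critical_point (I_hat V \<phi> h) \<gamma>\<^sub>0"
    and "0 < I_hat V \<phi> h \<gamma>\<^sub>0"
    and "0 < I_0 V r\<^sub>0"
    and "0 < I_0 V r\<^sub>0 * (6 * B_fun V \<phi> h \<gamma>\<^sub>0 + I_2 V r\<^sub>0) - (I_1 V r\<^sub>0)\<^sup>2"
  shows "2 \<le> morse_index_r (I_hat V \<phi> h) \<gamma>\<^sub>0"
proof -
  have "0 \<le> A_fun \<gamma>\<^sub>0"
    by (simp add: A_fun_eq_kinetic planar kinetic_planar integral_nonneg L2_h1_deriv_products)
  then have pos: "0 < A_fun \<gamma>\<^sub>0" "0 < B_fun V \<phi> h \<gamma>\<^sub>0"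
    using assms(18) by (auto simp: I_hat_def zero_less_mult_iff)
  define basis :: "path_space set" where "basis = {(r\<^sub>0, 0), (one_h1, 0)}"
  have "(r\<^sub>0, 0) \<notin> span {(one_h1, 0 :: h10)}"
  proof
    assume "(r\<^sub>0, 0) \<in> span {(one_h1, 0 :: h10)}"
    then obtain c where "r\<^sub>0 = c *\<^sub>R one_h1"
      by (auto simp: span_singleton)
    then have "\<forall>t\<in>{0..1}. curve \<gamma>\<^sub>0 t = (c, 0)"
      by (simp add: planar curve_def h10_h1_zero one_h1_fun)
    then show False
      using assms(16) by blast
  qed
  moreover from this have "r\<^sub>0 \<noteq> one_h1"
    using span_base[of "(one_h1, 0 :: h10)" "{(one_h1, 0)}"] by auto
  moreover have "one_h1 \<noteq> 0"
    using one_h1_fun[of 0] by auto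
  ultimately have "independent basis" "card basis = 2"
    unfolding basis_def
    by (auto simp: independent_insert span_base zero_prod_def)
  then have dim: "dim (span basis) = 2"
    using dim_span_eq_card_independent[of basis] by simp
  have "enat (dim (span basis)) \<le> morse_index_r (I_hat V \<phi> h) \<gamma>\<^sub>0"
    unfolding morse_index_r_def
  proof (rule morse_index_on_ge)
    have combination: "\<exists>x y. v = (x *\<^sub>R one_h1 + y *\<^sub>R r\<^sub>0, 0)" if "v \<in> span basis" for v
      using that by (auto simp: basis_def span_insert span_singleton algebra_simps) (metis add.commute)
    then show "span basis \<subseteq> {(u, 0) |u. True}"
      by blast
    fix v assume v: "v \<in> span basis" "v \<noteq> 0"
    then obtain x y where xy: "v = (x *\<^sub>R one_h1 + y *\<^sub>R r\<^sub>0, 0)"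
      using combination by blast
    then have "x \<noteq> 0 \<or> y \<noteq> 0"
      using v(2) by (auto simp: zero_prod_def)
    then have "0 < x\<^sup>2 * I_0 V r\<^sub>0 + 2 * x * y * I_1 V r\<^sub>0 + y\<^sup>2 * (6 * B_fun V \<phi> h \<gamma>\<^sub>0 + I_2 V r\<^sub>0)"
      using assms(19,20) by (intro quadratic_form_pos)
    then have "0 < 6 * y\<^sup>2 * B_fun V \<phi> h \<gamma>\<^sub>0
        + (x\<^sup>2 * I_0 V r\<^sub>0 + 2 * x * y * I_1 V r\<^sub>0 + y\<^sup>2 * I_2 V r\<^sub>0)"
      by (simp add: algebra_simps)
    then show "blinfun_apply (second_deriv (I_hat V \<phi> h) \<gamma>\<^sub>0 v) v < 0"
      unfolding xy second_deriv_constants_dilations[OF V1 V3 h(1) \<epsilon>(1,3) \<phi> planar assms(15) crit pos]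
      using pos(1) by (simp add: mult_less_0_iff)
  qed (auto simp: basis_def)
  then show ?thesis
    unfolding dim numeral_eq_enat .
qed

end
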